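(* For every positive integer $f$ with $\gcd(f,6)=1$ there exists a simple $3-\bigl(2(2^f+1),5,15(2^f-1)\bigr)$ design.
   Context: A $t-(v,k,\lambda)$ design is a pair $(X,\mathcal B)$ with $|X|=v$ and $\mathcal B$ a collection of $k$-subsets (blocks) of $X$ such that every $t$-subset of $X$ is contained in exactly $\lambda$ blocks. It is simple if it has no repeated blocks.
   Formalization: The case f = 1 is excluded: there the claim would give a simple 3-(6,5,15) design, which does not exist because a 6-set has only six 5-subsets and each 3-subset lies in just three of them. *)

theory Defs
  imports Main "HOL-Library.Multiset"
begin

text \<open>
  A block collection is a multiset, so that a block may be repeated and simplicity is a
  genuine condition; blocks containing a given \<open>t\<close>-subset are counted with multiplicity.
\<close>

definition t_design :: "nat \<Rightarrow> nat \<Rightarrow> nat \<Rightarrow> nat \<Rightarrow> 'a set \<Rightarrow> 'a set multiset \<Rightarrow> bool" where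
  "t_design t v k l X \<B> \<longleftrightarrow>
     finite X \<and> card X = v \<and>
     (\<forall>B \<in># \<B>. B \<subseteq> X \<and> card B = k) \<and>
     (\<forall>T. T \<subseteq> X \<and> card T = t \<longrightarrow> size {#B \<in># \<B>. T \<subseteq> B#} = l)"

definition simple_blocks :: "'a set multiset \<Rightarrow> bool" where
  "simple_blocks \<B> \<longleftrightarrow> (\<forall>B. count \<B> B \<le> 1)"

text \<open>
  At \<open>f = 1\<close> the parameters \<open>3-(2(2^f + 1), 5, 15(2^f - 1))\<close> are \<open>3-(6, 5, 15)\<close>, which no
  simple design has: a \<open>6\<close>-set has only six \<open>5\<close>-subsets. The value \<open>f = 1\<close> therefore has
  to be excluded from the existence statement.
\<close>

lemma no_simple_3_6_5_15_design:
  "\<not> (\<exists>(X :: 'a set) \<B>. t_design 3 6 5 15 X \<B> \<and> simple_blocks \<B>)"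
proof
  assume "\<exists>(X :: 'a set) \<B>. t_design 3 6 5 15 X \<B> \<and> simple_blocks \<B>"
  then obtain X :: "'a set" and \<B> where d: "t_design 3 6 5 15 X \<B>" and s: "simple_blocks \<B>"
    by blast
  have fin: "finite X" and card: "card X = 6"
    using d by (auto simp: t_design_def)
  obtain T where T: "T \<subseteq> X" "card T = 3"
    using obtain_subset_with_card_n[of 3 X] card by auto
  have "15 = size {#B \<in># \<B>. T \<subseteq> B#}"
    using d T by (auto simp: t_design_def)
  also have "\<dots> \<le> size \<B>"
    by (rule size_mset_mono) simp
  also have "\<dots> = (\<Sum>B \<in> set_mset \<B>. count \<B> B)"
    by (rule size_multiset_overloaded_eq)
  also have "\<dots> \<le> (\<Sum>B \<in> set_mset \<B>. 1)"
    by (rule sum_mono) (use s in \<open>auto simp: simple_blocks_def\<close>)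
  also have "\<dots> = card (set_mset \<B>)"
    by simp
  also have "\<dots> \<le> card {B. B \<subseteq> X \<and> card B = 5}"
    by (rule card_mono) (use d fin in \<open>auto simp: t_design_def\<close>)
  also have "\<dots> = 6 choose 5"
    using n_subsets[OF fin, of 5] card by simp
  also have "\<dots> = 6"
    by (simp add: numeral_eq_Suc)
  finally show False
    by simp
qed

end

theory Submission
  imports Defs "HOL-Algebra.Algebraic_Closure_Type" "HOL-Library.Z2"
begin

text \<open>
  Put q = 2^f and let G = PGL(2,q) act on the q + 1 points of the projective line P; it is sharply
  3-transitive, so g := |G| = (q+1)q(q-1). The points of the design are the two copies P \<times> {0,1}
  of the line, and the group H of order 2g generated by G, acting on both copies at once, and by the
  exchange of the copies acts on them. A fibre consists of the two copies of one point. By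
  3-transitivity H has only three orbits on triples: the triples inside one copy (g/3 of
  them), the triples that contain a fibre (2(q+1)q of them), and the remaining, mixed triples (g of
  them). Hence any H-invariant family of blocks is a 3-design as soon as its blocks contain, in
  total, the right number of triples from each orbit: existence becomes a question of sizes.

  A block that splits as 4+1 or 3+2 over the two copies contains 4 or 1 triples of the first kind,
  and 3d triples of the second kind if it contains d fibres. Taking

    \<^item> (q-2)g blocks of type 4+1 with d = 0,
    \<^item> (q-6)g blocks of type 3+2 with d = 0,
    \<^item> 8g blocks of type 3+2 with d = 1,
    \<^item> all g blocks of type 3+2 with d = 2

  gives 5(q-1)g, 30g and 15(q-1)g incidences with the three orbits of triples, which is
  15(q-1) blocks through every triple.

  Since q is even, the sizes of the first three families are multiples of |H| = 2g, so it suffices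
  to find enough blocks with trivial stabiliser and to take unions of their orbits (\<open>invariant_subfamily_of_regular_orbits\<close>).
  For 3+2 the stabiliser of the three points in one copy has at most nine elements, and each
  of its non-identity elements spoils few pairs (\<open>irregular_disjoint_pairs\<close>,
  \<open>irregular_meeting_pairs\<close>). For 4+1 move the single point to infinity. A nontrivial affine map
  that permutes four field elements in characteristic two forces their sum to vanish
  (\<open>sum_zero_of_affine_invariant\<close>), so the fourth element is determined by the other three, and at
  most binomial(q,3) of the 4-subsets are spoiled (\<open>irregular_four_one\<close>). The counts suffice for
  q \<ge> 32, and coprimality of f and 6 together with f \<noteq> 1 gives f \<ge> 5.
\<close>

(* This algebraic notation would turn the letter X, the name of a point set below, into a keyword. *)
no_notation Polynomials.var (\<open>X\<index>\<close>)

section \<open>Groups of permutations and invariant families of sets\<close>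

definition perm_group :: "('x \<Rightarrow> 'x) set \<Rightarrow> bool" where
  "perm_group H \<longleftrightarrow> id \<in> H \<and> (\<forall>g\<in>H. \<forall>h\<in>H. g \<circ> h \<in> H) \<and>
     (\<forall>g\<in>H. \<exists>h\<in>H. h \<circ> g = id \<and> g \<circ> h = id)"

lemma perm_groupD:
  assumes "perm_group H"
  shows "id \<in> H"
    and "\<And>g h. g \<in> H \<Longrightarrow> h \<in> H \<Longrightarrow> g \<circ> h \<in> H"
    and "\<And>g. g \<in> H \<Longrightarrow> \<exists>h\<in>H. h \<circ> g = id \<and> g \<circ> h = id"
  using assms by (auto simp: perm_group_def)

lemma perm_group_inj:
  assumes "perm_group H" "g \<in> H"
  shows "inj g"
  using perm_groupD(3)[OF assms] by (metis inj_on_id inj_on_imageI2)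

definition invariant_under :: "('x \<Rightarrow> 'x) set \<Rightarrow> 'x set set \<Rightarrow> bool" where
  "invariant_under H F \<longleftrightarrow> (\<forall>h\<in>H. \<forall>B\<in>F. h ` B \<in> F)"

text \<open>The orbit of such a set under a finite group \<open>H\<close> has exactly \<open>card H\<close> members.\<close>
definition regular_in :: "('x \<Rightarrow> 'x) set \<Rightarrow> 'x set \<Rightarrow> bool" where
  "regular_in H B \<longleftrightarrow> (\<forall>h\<in>H. h ` B = B \<longrightarrow> h = id)"

text \<open>
  Regular orbits all have the same size, so one can add them one at a time until a prescribed
  multiple of the group order is reached.
\<close>
lemma invariant_subfamily_of_regular_orbits:
  assumes H: "perm_group H" "finite H"
    and inv: "invariant_under H \<Omega>"
    and "m * card H \<le> card {B \<in> \<Omega>. regular_in H B}"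
  shows "\<exists>F. F \<subseteq> \<Omega> \<and> finite F \<and> invariant_under H F \<and> card F = m * card H"
  using assms(4)
proof (induction m)
  case 0
  show ?case
    by (intro exI[of _ "{}"]) (simp add: invariant_under_def)
next
  case (Suc m)
  then obtain F where F: "F \<subseteq> \<Omega>" "finite F" "invariant_under H F" "card F = m * card H"
    by auto
  have "card H > 0"
    using perm_groupD(1)[OF H(1)] H(2) by (auto simp: card_gt_0_iff)
  then have "card F < card {B \<in> \<Omega>. regular_in H B}"
    using Suc.prems F(4) by simp
  then have "\<not> {B \<in> \<Omega>. regular_in H B} \<subseteq> F"
    using card_mono[OF F(2)] by (meson not_le)
  then obtain B where B: "B \<in> \<Omega>" "regular_in H B" "B \<notin> F"
    by blast
  define orb where "orb = (\<lambda>h. h ` B) ` H"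
  have "inj_on (\<lambda>h. h ` B) H"
  proof (rule inj_onI)
    fix h k assume hk: "h \<in> H" "k \<in> H" "h ` B = k ` B"
    then obtain k' where k': "k' \<in> H" "k' \<circ> k = id" "k \<circ> k' = id"
      using perm_groupD(3)[OF H(1)] by blast
    have "(k' \<circ> h) ` B = (k' \<circ> k) ` B"
      using hk(3) by (simp only: image_comp[symmetric])
    then have "k' \<circ> h = id"
      using B(2) perm_groupD(2)[OF H(1) k'(1) hk(1)] k'(2) by (simp add: regular_in_def)
    then have "k \<circ> (k' \<circ> h) = k"
      by simp
    then show "h = k"
      using k'(3) by (simp flip: comp_assoc)
  qed
  then have card_orb: "card orb = card H"
    by (simp add: orb_def card_image)
  have disj: "F \<inter> orb = {}"
  proof -
    have "h ` B \<notin> F" if "h \<in> H" for h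
    proof
      assume "h ` B \<in> F"
      moreover obtain h' where h': "h' \<in> H" "h' \<circ> h = id"
        using perm_groupD(3)[OF H(1) \<open>h \<in> H\<close>] by blast
      ultimately have "h' ` (h ` B) \<in> F"
        using F(3) by (auto simp: invariant_under_def)
      then show False
        using h'(2) B(3) by (simp add: image_comp)
    qed
    then show ?thesis
      by (auto simp: orb_def)
  qed
  have "invariant_under H orb"
    unfolding invariant_under_def orb_def
    using imageI[OF perm_groupD(2)[OF H(1)], of _ _ "\<lambda>h. h ` B"]
    by (auto simp only: image_comp ball_simps)
  moreover have "orb \<subseteq> \<Omega>"
    using inv B(1) by (auto simp: orb_def invariant_under_def)
  moreover have "card (F \<union> orb) = Suc m * card H"
    using F(2,4) disj card_orb H(2) by (subst card_Un_disjoint) (auto simp: orb_def)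
  ultimately show ?case
    using F H(2) by (intro exI[of _ "F \<union> orb"]) (auto simp: invariant_under_def orb_def)
qed

text \<open>
  The number of members of \<open>F\<close> above \<open>T\<close> does not depend on \<open>T\<close> by transitivity; counting the pairs
  \<open>T \<subseteq> B\<close> in two ways then determines it. This turns the design condition into an equation of sizes.
\<close>
lemma count_on_transitive_family:
  assumes H: "perm_group H"
    and fin: "finite \<T>" "finite F"
    and inv: "invariant_under H F"
    and trans: "\<And>T T'. T \<in> \<T> \<Longrightarrow> T' \<in> \<T> \<Longrightarrow> \<exists>h\<in>H. h ` T = T'"
    and T: "T \<in> \<T>"
  shows "card {B \<in> F. T \<subseteq> B} * card \<T> = (\<Sum>B\<in>F. card {T \<in> \<T>. T \<subseteq> B})"
proof -
  have le: "card {B \<in> F. T1 \<subseteq> B} \<le> card {B \<in> F. T2 \<subseteq> B}"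
    if T12: "T1 \<in> \<T>" "T2 \<in> \<T>" for T1 T2
  proof -
    obtain h where h: "h \<in> H" "h ` T1 = T2"
      using trans T12 by blast
    have "inj_on ((`) h) {B \<in> F. T1 \<subseteq> B}"
      using perm_group_inj[OF H h(1)] by (meson inj_image_eq_iff inj_onI)
    moreover have "(`) h ` {B \<in> F. T1 \<subseteq> B} \<subseteq> {B \<in> F. T2 \<subseteq> B}"
      using inv h by (auto simp: invariant_under_def)
    ultimately show ?thesis
      using fin(2) by (intro card_inj_on_le) auto
  qed
  have "(\<Sum>B\<in>F. card {T \<in> \<T>. T \<subseteq> B}) = (\<Sum>T'\<in>\<T>. card {B \<in> F. T' \<subseteq> B})"
    by (rule sum_multicount_gen) (use fin in auto)
  also have "\<dots> = (\<Sum>T'\<in>\<T>. card {B \<in> F. T \<subseteq> B})"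
    by (rule sum.cong) (use le T in \<open>auto intro: le_antisym\<close>)
  finally show ?thesis
    by simp
qed

section \<open>Triples in two copies of a point set\<close>

text \<open>
  Points of the doubled set are pairs of a point and a Boolean level. The next three definitions
  split the triples according to their position relative to the levels and to the fibres of the
  first projection; on the doubled line these will be the orbits of the group.
\<close>
definition level_triples :: "('p \<times> bool) set \<Rightarrow> ('p \<times> bool) set set" where
  "level_triples B = {T. T \<subseteq> B \<and> card T = 3 \<and> (\<exists>i. snd ` T \<subseteq> {i})}"

definition fibre_triples :: "('p \<times> bool) set \<Rightarrow> ('p \<times> bool) set set" where
  "fibre_triples B = {T. T \<subseteq> B \<and> card T = 3 \<and> \<not> inj_on fst T}"

definition mixed_triples :: "('p \<times> bool) set \<Rightarrow> ('p \<times> bool) set set" where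
  "mixed_triples B = {T. T \<subseteq> B \<and> card T = 3} - level_triples B - fibre_triples B"

lemma level_tripleE:
  assumes "T \<in> level_triples B"
  obtains a b c i where "T = {(a, i), (b, i), (c, i)}" "distinct [a, b, c]" "T \<subseteq> B"
proof -
  from assms obtain i where T: "T \<subseteq> B" "card T = 3" "snd ` T \<subseteq> {i}"
    by (auto simp: level_triples_def)
  then obtain x y z where xyz: "T = {x, y, z}" "x \<noteq> y" "x \<noteq> z" "y \<noteq> z"
    by (auto simp: card_3_iff)
  then have "x = (fst x, i)" "y = (fst y, i)" "z = (fst z, i)"
    using T(3) by (auto simp: prod_eq_iff)
  then show ?thesis
    using that[of "fst x" i "fst y" "fst z"] xyz T(1) by (metis distinct_length_2_or_more distinct_singleton)
qed

lemma fibre_tripleE: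
  assumes "T \<in> fibre_triples B"
  obtains a b i where "T = {(a, False), (a, True), (b, i)}" "a \<noteq> b" "T \<subseteq> B"
proof -
  from assms have T: "T \<subseteq> B" "card T = 3" "\<not> inj_on fst T"
    by (auto simp: fibre_triples_def)
  then obtain x y where xy: "x \<in> T" "y \<in> T" "fst x = fst y" "x \<noteq> y"
    by (auto simp: inj_on_def)
  have fin: "finite T"
    using T(2) by (simp add: card_ge_0_finite)
  have "card (T - {x, y}) = 1"
    using T(2) xy fin by (simp add: card_Diff_subset)
  then obtain z where z: "T - {x, y} = {z}"
    by (auto simp: card_1_singleton_iff)
  define a where "a = fst x"
  have "{x, y} = {(a, False), (a, True)}"
    using xy(3,4) unfolding a_def
    by (cases x; cases y; cases "snd x"; cases "snd y") auto
  moreover have "T = {x, y} \<union> {z}" "z \<notin> {x, y}"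
    using z xy by auto
  ultimately have "T = {(a, False), (a, True), z}" "z \<notin> {(a, False), (a, True)}"
    by auto
  moreover from this(2) have "a \<noteq> fst z"
    by (cases z; cases "snd z") auto
  ultimately show ?thesis
    using that[of a "fst z" "snd z"] T(1) by simp
qed

lemma mixed_tripleE:
  assumes "T \<in> mixed_triples B"
  obtains a b c i where "T = {(a, i), (b, i), (c, \<not> i)}" "distinct [a, b, c]" "T \<subseteq> B"
proof -
  have T: "T \<subseteq> B" "card T = 3"
    and "T \<notin> level_triples B" "T \<notin> fibre_triples B"
    using assms by (simp_all add: mixed_triples_def)
  then have "inj_on fst T" and nl: "\<not> snd ` T \<subseteq> {i}" for i
    by (simp_all add: level_triples_def fibre_triples_def)
  obtain x y z where xyz: "T = {x, y, z}" "x \<noteq> y" "x \<noteq> z" "y \<noteq> z"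
    using T(2) unfolding card_3_iff by blast
  obtain a i where a: "x = (a, i)" by fastforce
  obtain b j where b: "y = (b, j)" by fastforce
  obtain c k where c: "z = (c, k)" by fastforce
  have d: "distinct [a, b, c]"
    using \<open>inj_on fst T\<close> xyz inj_on_eq_iff[of fst T x y] inj_on_eq_iff[of fst T x z]
      inj_on_eq_iff[of fst T y z] by (simp add: a b c)
  have "\<not> (i = j \<and> j = k)"
    using nl[of i] by (simp add: xyz a b c) argo
  then have "j = i \<and> k = (\<not> i) \<or> k = i \<and> j = (\<not> i) \<or> k = j \<and> i = (\<not> j)"
    by argo
  then consider "j = i" "k = (\<not> i)" | "k = i" "j = (\<not> i)" | "k = j" "i = (\<not> j)"
    by blast
  then show ?thesis
  proof cases
    case 1
    show ?thesis
      by (rule that[of a i b c]) (use d T(1) in \<open>auto simp: xyz a b c 1\<close>)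
  next
    case 2
    show ?thesis
      by (rule that[of a i c b]) (use d T(1) in \<open>auto simp: xyz a b c 2\<close>)
  next
    case 3
    show ?thesis
      by (rule that[of b j c a]) (use d T(1) in \<open>auto simp: xyz a b c 3\<close>)
  qed
qed

text \<open>
  The two counts below are stated for any finite set, because they serve both for a single block and
  for the whole point set.
\<close>
lemma card_level_triples:
  assumes "finite B"
  shows "card (level_triples B) =
    (card {p. (p, False) \<in> B} choose 3) + (card {p. (p, True) \<in> B} choose 3)"
proof -
  define L where "L = (\<lambda>i. {x \<in> B. snd x = i})"
  have finL: "finite (L i)" for i
    using assms by (simp add: L_def)
  have cardL: "card (L i) = card {p. (p, i) \<in> B}" for i
  proof -
    have "L i = (\<lambda>p. (p, i)) ` {p. (p, i) \<in> B}"
      by (auto simp: L_def)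
    then show ?thesis
      by (simp add: card_image inj_on_def)
  qed
  have split: "level_triples B = {T. T \<subseteq> L False \<and> card T = 3} \<union> {T. T \<subseteq> L True \<and> card T = 3}"
  proof -
    have "(\<exists>i. snd ` T \<subseteq> {i}) \<longleftrightarrow> snd ` T \<subseteq> {False} \<or> snd ` T \<subseteq> {True}" for T :: "('a \<times> bool) set"
      by (simp add: ex_bool_eq disj_commute)
    moreover have "T \<subseteq> L i \<longleftrightarrow> T \<subseteq> B \<and> snd ` T \<subseteq> {i}" for T i
      by (auto simp: L_def)
    ultimately show ?thesis
      unfolding level_triples_def by (intro Set.set_eqI) (simp only: Un_iff mem_Collect_eq, argo)
  qed
  have empty: "T = {}" if "T \<subseteq> L False" "T \<subseteq> L True" for T
    using that by (auto simp: L_def)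
  have disj: "{T. T \<subseteq> L False \<and> card T = 3} \<inter> {T. T \<subseteq> L True \<and> card T = 3} = {}"
  proof (intro equals0I)
    fix T assume "T \<in> {T. T \<subseteq> L False \<and> card T = 3} \<inter> {T. T \<subseteq> L True \<and> card T = 3}"
    then have "T = {}" "card T = 3"
      using empty by simp_all
    then show False
      by simp
  qed
  have fin: "finite {T. T \<subseteq> L i \<and> card T = 3}" for i
    by (rule finite_subset[of _ "Pow (L i)"]) (use finL in auto)
  have "card (level_triples B) = card {T. T \<subseteq> L False \<and> card T = 3} + card {T. T \<subseteq> L True \<and> card T = 3}"
    unfolding split by (rule card_Un_disjoint[OF fin fin disj])
  then show ?thesis
    by (simp only: n_subsets[OF finL] cardL)
qed

text \<open>A triple with two points over the same \<open>p\<close> is that whole fibre and one further point.\<close>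
lemma card_fibre_triples:
  assumes "finite B"
  shows "card (fibre_triples B) = card {p. (p, False) \<in> B \<and> (p, True) \<in> B} * (card B - 2)"
proof -
  define D where "D = {p. (p, False) \<in> B \<and> (p, True) \<in> B}"
  define V where "V = (\<lambda>p. B - {(p, False), (p, True)})"
  define \<tau> where "\<tau> = (\<lambda>(p, y). {(p, False), (p, True), y :: 'a \<times> bool})"
  have "D \<subseteq> fst ` B"
    by (force simp: D_def)
  then have "finite D"
    using assms finite_surj by blast
  have im: "fibre_triples B = \<tau> ` Sigma D V"
  proof (intro equalityI subsetI)
    fix T assume "T \<in> fibre_triples B"
    then obtain a b i where T: "T = {(a, False), (a, True), (b, i)}" "a \<noteq> b" "T \<subseteq> B"
      by (rule fibre_tripleE)
    then show "T \<in> \<tau> ` Sigma D V"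
      by (intro image_eqI[of _ _ "(a, (b, i))"]) (auto simp: \<tau>_def D_def V_def)
  next
    fix T assume "T \<in> \<tau> ` Sigma D V"
    then obtain p y where py: "T = {(p, False), (p, True), y}" "p \<in> D" "y \<in> V p"
      by (auto simp: \<tau>_def)
    then have "card T = 3" "T \<subseteq> B"
      by (auto simp: D_def V_def)
    moreover have "\<not> inj_on fst T"
      by (auto simp: py inj_on_def)
    ultimately show "T \<in> fibre_triples B"
      by (simp add: fibre_triples_def)
  qed
  have "inj_on \<tau> (Sigma D V)"
  proof (rule inj_onI, clarify)
    fix p a i q b j
    assume V: "(a, i) \<in> V p" "(b, j) \<in> V q" and eq: "\<tau> (p, (a, i)) = \<tau> (q, (b, j))"
    have "a \<noteq> p" "b \<noteq> q"
      using V by (auto simp: V_def)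
    moreover have "{(p, False), (p, True), (a, i)} = {(q, False), (q, True), (b, j)}"
      using eq by (simp add: \<tau>_def)
    moreover from this have "(p, False) \<in> {(q, False), (q, True), (b, j)}"
      "(p, True) \<in> {(q, False), (q, True), (b, j)}" "(a, i) \<in> {(q, False), (q, True), (b, j)}"
      by blast+
    ultimately show "p = q \<and> (a, i) = (b, j)"
      by auto
  qed
  then have "card (fibre_triples B) = (\<Sum>p\<in>D. card (V p))"
    unfolding im using \<open>finite D\<close> assms by (simp add: card_image V_def)
  also have "\<dots> = (\<Sum>p\<in>D. card B - 2)"
    by (rule sum.cong) (auto simp: V_def D_def card_Diff_subset)
  finally show ?thesis
    by (simp add: D_def)
qed

lemma card_mixed_triples:
  assumes "finite B"
  shows "card (level_triples B) + card (fibre_triples B) + card (mixed_triples B) = card B choose 3"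
proof -
  have fin: "finite {T. T \<subseteq> B \<and> card T = 3}"
    by (rule finite_subset[of _ "Pow B"]) (use assms in auto)
  have "T \<notin> fibre_triples B" if T: "T \<in> level_triples B" for T
  proof -
    obtain a b c i where "T = {(a, i), (b, i), (c, i)}"
      using T by (rule level_tripleE)
    then have "inj_on fst T"
      by (simp add: inj_on_def)
    then show ?thesis
      by (simp add: fibre_triples_def)
  qed
  then have disj: "level_triples B \<inter> fibre_triples B = {}"
    by blast
  have sub: "level_triples B \<union> fibre_triples B \<subseteq> {T. T \<subseteq> B \<and> card T = 3}"
    unfolding level_triples_def fibre_triples_def by blast
  have "mixed_triples B = {T. T \<subseteq> B \<and> card T = 3} - (level_triples B \<union> fibre_triples B)"
    unfolding mixed_triples_def by blast
  moreover have "card (level_triples B \<union> fibre_triples B) = card (level_triples B) + card (fibre_triples B)"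
    using sub fin disj by (intro card_Un_disjoint) (auto intro: finite_subset)
  moreover have "card (level_triples B \<union> fibre_triples B) \<le> card {T. T \<subseteq> B \<and> card T = 3}"
    using sub fin by (rule card_mono[rotated])
  ultimately show ?thesis
    using card_Diff_subset[OF finite_subset[OF sub fin] sub] by (simp add: n_subsets[OF assms])
qed

text \<open>The block with part \<open>A\<close> on level \<open>i\<close> and part \<open>B\<close> on the other level.\<close>
definition split_block :: "bool \<Rightarrow> 'p set \<Rightarrow> 'p set \<Rightarrow> ('p \<times> bool) set" where
  "split_block i A B = A \<times> {i} \<union> B \<times> {\<not> i}"

lemma finite_split_block [simp]: "finite A \<Longrightarrow> finite B \<Longrightarrow> finite (split_block i A B)"
  by (simp add: split_block_def)

lemma card_split_block: "finite A \<Longrightarrow> finite B \<Longrightarrow> card (split_block i A B) = card A + card B"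
  unfolding split_block_def by (subst card_Un_disjoint) auto

lemma split_block_sections:
  "{p. (p, i) \<in> split_block i A B} = A" "{p. (p, \<not> i) \<in> split_block i A B} = B"
  by (auto simp: split_block_def)

text \<open>
  Parts of different sizes cannot be exchanged, so the larger one reveals its level. In particular
  no element that exchanges the levels can stabilise such a block.
\<close>
lemma split_block_inject:
  assumes "split_block i A B = split_block j A' B'" "card A \<noteq> card B'"
  shows "i = j \<and> A = A' \<and> B = B'"
  using assms split_block_sections[of i A B] split_block_sections[of j A' B']
  by (cases "i = j") auto

lemma triples_of_split_block:
  assumes "finite A" "finite B" 
  shows "card (level_triples (split_block i A B)) = (card A choose 3) + (card B choose 3)"
    and "card (fibre_triples (split_block i A B)) = card (A \<inter> B) * (card A + card B - 2)"
proof -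
  show "card (level_triples (split_block i A B)) = (card A choose 3) + (card B choose 3)"
    using assms split_block_sections[of i A B] by (cases i) (simp_all add: card_level_triples)
  have "{p. (p, False) \<in> split_block i A B \<and> (p, True) \<in> split_block i A B} = A \<inter> B"
    by (cases i) (auto simp: split_block_def)
  then show "card (fibre_triples (split_block i A B)) = card (A \<inter> B) * (card A + card B - 2)"
    using assms by (simp add: card_fibre_triples card_split_block)
qed

section \<open>Sharply 3-transitive groups and their doubling\<close>

lemma six_times_choose_3: "6 * (n choose 3) = n * (n - 1) * (n - 2)"
proof (induction n)
  case (Suc n)
  have two: "2 * (n choose 2) = n * (n - 1)"
    by (cases n) (simp_all add: choose_two)
  have "6 * (Suc n choose 3) = 6 * (n choose 2) + 6 * (n choose 3)"
    by (simp add: numeral_3_eq_3 numeral_2_eq_2)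
  also have "\<dots> = 3 * (n * (n - 1)) + n * (n - 1) * (n - 2)"
    using two Suc.IH by simp
  also have "\<dots> = Suc n * (Suc n - 1) * (Suc n - 2)"
  proof (cases "n \<ge> 2")
    case True
    then obtain m where "n = m + 2"
      by (metis add.commute le_Suc_ex)
    then show ?thesis
      by (simp add: algebra_simps)
  next
    case False
    then have "n = 0 \<or> n = 1"
      by auto
    then show ?thesis
      by auto
  qed
  finally show ?case .
qed simp

lemma choose_2_times_2: "2 * (n choose 2) = n * (n - 1)"
  by (cases n) (simp_all add: choose_two)

lemma choose_4_times_4: "4 * (n choose 4) = (n - 3) * (n choose 3)"
  using binomial_absorption[of 3 n] binomial_absorb_comp[of n 3] by simp

locale sharply_3_transitive =
  fixes G :: "('p \<Rightarrow> 'p) set" and P :: "'p set"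
  assumes finite_points: "finite P"
    and three_points: "3 \<le> card P"
    and group: "perm_group G"
    and maps_points: "g \<in> G \<Longrightarrow> x \<in> P \<Longrightarrow> g x \<in> P"
    and transitive: "distinct [a, b, c] \<Longrightarrow> {a, b, c} \<subseteq> P \<Longrightarrow> distinct [a', b', c'] \<Longrightarrow>
      {a', b', c'} \<subseteq> P \<Longrightarrow> \<exists>g\<in>G. g a = a' \<and> g b = b' \<and> g c = c'"
    and sharp: "g \<in> G \<Longrightarrow> distinct [a, b, c] \<Longrightarrow> {a, b, c} \<subseteq> P \<Longrightarrow>
      g a = a \<Longrightarrow> g b = b \<Longrightarrow> g c = c \<Longrightarrow> g = id"
begin

lemma unique_on_triples:
  assumes "g \<in> G" "h \<in> G" "distinct [a, b, c]" "{a, b, c} \<subseteq> P"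
    and "g a = h a" "g b = h b" "g c = h c"
  shows "g = h"
proof -
  obtain h' where h': "h' \<in> G" "h' \<circ> h = id" "h \<circ> h' = id"
    using perm_groupD(3)[OF group assms(2)] by blast
  have h'h: "h' (h x) = x" for x
    using h'(2) by (metis comp_apply id_apply)
  have "h' \<circ> g = id"
    by (rule sharp[of _ a b c])
       (use perm_groupD(2)[OF group h'(1) assms(1)] assms in \<open>simp_all add: h'h\<close>)
  then have "h \<circ> (h' \<circ> g) = h"
    by simp
  then show ?thesis
    using h'(3) by (simp flip: comp_assoc)
qed

lemma ex_three_points: "\<exists>a b c. distinct [a, b, c] \<and> {a, b, c} \<subseteq> P"
proof -
  obtain T where "T \<subseteq> P" "card T = 3"
    using obtain_subset_with_card_n[OF three_points] by blast
  then show ?thesis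
    unfolding card_3_iff by (metis distinct_length_2_or_more distinct_singleton)
qed

lemma transitive_pairs:
  assumes "a \<noteq> b" "{a, b} \<subseteq> P" "a' \<noteq> b'" "{a', b'} \<subseteq> P"
  shows "\<exists>g\<in>G. g a = a' \<and> g b = b'"
proof -
  have "\<exists>c. c \<in> P - {x, y}" for x y
  proof -
    have "card {x, y} < card P"
      using three_points by (simp add: card_insert_if)
    then have "\<not> P \<subseteq> {x, y}"
      by (meson card_mono finite.emptyI finite.insertI not_le)
    then show ?thesis
      by blast
  qed
  then obtain c c' where c: "c \<in> P - {a, b}" "c' \<in> P - {a', b'}"
    by metis
  then show ?thesis
    using transitive[of a b c a' b' c'] assms by auto
qed

text \<open>Sharp 3-transitivity identifies the group with the set of ordered triples of points.\<close>
lemma bij_betw_triples: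
  assumes "distinct [a, b, c]" "{a, b, c} \<subseteq> P"
  shows "bij_betw (\<lambda>g. [g a, g b, g c]) G {xs. length xs = 3 \<and> distinct xs \<and> set xs \<subseteq> P}"
proof (rule bij_betwI')
  fix g h assume "g \<in> G" "h \<in> G"
  then show "([g a, g b, g c] = [h a, h b, h c]) = (g = h)"
    using unique_on_triples[OF _ _ assms] by auto
next
  fix g assume "g \<in> G"
  moreover from this have "inj g"
    by (rule perm_group_inj[OF group])
  ultimately show "[g a, g b, g c] \<in> {xs. length xs = 3 \<and> distinct xs \<and> set xs \<subseteq> P}"
    using assms maps_points by (auto dest: injD)
next
  fix xs assume xs: "xs \<in> {xs. length xs = 3 \<and> distinct xs \<and> set xs \<subseteq> P}"
  then obtain a' b' c' where abc: "xs = [a', b', c']"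
    by (auto simp: numeral_3_eq_3 length_Suc_conv)
  then show "\<exists>g\<in>G. xs = [g a, g b, g c]"
    using transitive[OF assms, of a' b' c'] xs by (auto intro: bexI)
qed

lemma finite_group: "finite G"
proof -
  obtain a b c where "distinct [a, b, c]" "{a, b, c} \<subseteq> P"
    using ex_three_points by blast
  note bij = bij_betw_finite[OF bij_betw_triples[OF this]]
  show ?thesis
    unfolding bij by (rule finite_subset[OF _ finite_lists_length_eq[OF finite_points, of 3]]) auto
qed

lemma card_group: "card G = card P * (card P - 1) * (card P - 2)"
proof -
  obtain a b c where "distinct [a, b, c]" "{a, b, c} \<subseteq> P"
    using ex_three_points by blast
  from bij_betw_same_card[OF bij_betw_triples[OF this]]
  have "card G = \<Prod>{card P - 3 + 1 .. card P}"
    by (simp add: card_lists_distinct_length_eq[OF finite_points three_points])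
  moreover obtain m where "card P = m + 3"
    using three_points le_Suc_ex by (metis add.commute)
  moreover have "{m + 1..m + 3} = {m + 1, m + 2, m + 3}"
    by auto
  ultimately show ?thesis
    by (simp add: mult.commute mult.left_commute)
qed

lemma card_group_choose_3: "card G = 6 * (card P choose 3)"
  by (simp add: card_group six_times_choose_3)

definition doubled_points :: "('p \<times> bool) set" where
  "doubled_points = P \<times> UNIV"

definition doubled_group :: "('p \<times> bool \<Rightarrow> 'p \<times> bool) set" where
  "doubled_group = (\<lambda>(g, s). map_prod g s) ` (G \<times> {id, Not})"

lemma doubled_groupE:
  assumes "h \<in> doubled_group"
  obtains g s where "h = map_prod g s" "g \<in> G" "s \<in> {id, Not}"
  using assms by (auto simp: doubled_group_def)

lemma doubled_groupI: "g \<in> G \<Longrightarrow> s \<in> {id, Not} \<Longrightarrow> map_prod g s \<in> doubled_group"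
  by (auto simp: doubled_group_def)

lemma perm_group_doubled: "perm_group doubled_group"
proof -
  have "id \<in> doubled_group"
    using doubled_groupI[OF perm_groupD(1)[OF group], of id] by (simp add: map_prod.id)
  moreover have "g \<circ> h \<in> doubled_group" if gh: "g \<in> doubled_group" "h \<in> doubled_group" for g h
  proof -
    obtain g1 s where g: "g = map_prod g1 s" "g1 \<in> G" "s \<in> {id, Not}"
      using gh(1) by (rule doubled_groupE)
    obtain h1 t where h: "h = map_prod h1 t" "h1 \<in> G" "t \<in> {id, Not}"
      using gh(2) by (rule doubled_groupE)
    have "Not \<circ> Not = id"
      by (simp add: fun_eq_iff)
    then have "s \<circ> t \<in> {id, Not}"
      using g(3) h(3) by (elim insertE emptyE) simp_all
    then show ?thesis
      using doubled_groupI[OF perm_groupD(2)[OF group g(2) h(2)]] by (simp add: g(1) h(1) map_prod.comp)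
  qed
  moreover have "\<exists>h\<in>doubled_group. h \<circ> g = id \<and> g \<circ> h = id" if g: "g \<in> doubled_group" for g
  proof -
    obtain g1 s where g: "g = map_prod g1 s" "g1 \<in> G" "s \<in> {id, Not}"
      using g by (rule doubled_groupE)
    obtain h1 where h1: "h1 \<in> G" "h1 \<circ> g1 = id" "g1 \<circ> h1 = id"
      using perm_groupD(3)[OF group g(2)] by blast
    have "s \<circ> s = id"
      using g(3) by (elim insertE emptyE) (simp_all add: fun_eq_iff)
    then show ?thesis
      using doubled_groupI[OF h1(1) g(3)] h1
      by (intro bexI[of _ "map_prod h1 s"]) (simp_all add: g(1) map_prod.comp map_prod.id)
  qed
  ultimately show ?thesis
    by (simp add: perm_group_def)
qed

lemma finite_doubled_group: "finite doubled_group"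
  using finite_group by (simp add: doubled_group_def)

lemma card_doubled_group: "card doubled_group = 2 * card G"
proof -
  have "inj_on (\<lambda>(g, s). map_prod g s) (G \<times> {id, Not})"
    by (auto simp: inj_on_def fun_eq_iff)
  moreover have "(id :: bool \<Rightarrow> bool) \<noteq> Not"
    by (simp add: fun_eq_iff)
  ultimately show ?thesis
    by (simp add: doubled_group_def card_image card_cartesian_product)
qed

lemma ex_level_map: "\<exists>s\<in>{id, Not}. s i = j \<and> s (\<not> i) = (\<not> j)"
  by (cases i; cases j) auto

lemma transitive_level_triples:
  assumes "T \<in> level_triples doubled_points" "T' \<in> level_triples doubled_points"
  shows "\<exists>h\<in>doubled_group. h ` T = T'"
proof -
  obtain a b c i where T: "T = {(a, i), (b, i), (c, i)}" "distinct [a, b, c]" "T \<subseteq> doubled_points"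
    using assms(1) by (rule level_tripleE)
  obtain a' b' c' j where T': "T' = {(a', j), (b', j), (c', j)}" "distinct [a', b', c']" "T' \<subseteq> doubled_points"
    using assms(2) by (rule level_tripleE)
  obtain s where s: "s \<in> {id, Not}" "s i = j" "s (\<not> i) = (\<not> j)"
    using ex_level_map[of i j] by blast
  obtain g where g: "g \<in> G" "g a = a'" "g b = b'" "g c = c'"
    using transitive[OF T(2) _ T'(2)] T(1,3) T'(1,3) by (auto simp: doubled_points_def)
  show ?thesis
    using g s by (intro bexI[OF _ doubled_groupI[OF g(1) s(1)]]) (simp add: T(1) T'(1))
qed

lemma transitive_mixed_triples:
  assumes "T \<in> mixed_triples doubled_points" "T' \<in> mixed_triples doubled_points"
  shows "\<exists>h\<in>doubled_group. h ` T = T'"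
proof -
  obtain a b c i where T: "T = {(a, i), (b, i), (c, \<not> i)}" "distinct [a, b, c]" "T \<subseteq> doubled_points"
    using assms(1) by (rule mixed_tripleE)
  obtain a' b' c' j where T': "T' = {(a', j), (b', j), (c', \<not> j)}" "distinct [a', b', c']" "T' \<subseteq> doubled_points"
    using assms(2) by (rule mixed_tripleE)
  obtain s where s: "s \<in> {id, Not}" "s i = j" "s (\<not> i) = (\<not> j)"
    using ex_level_map[of i j] by blast
  obtain g where g: "g \<in> G" "g a = a'" "g b = b'" "g c = c'"
    using transitive[OF T(2) _ T'(2)] T(1,3) T'(1,3) by (auto simp: doubled_points_def)
  show ?thesis
    using g s by (intro bexI[OF _ doubled_groupI[OF g(1) s(1)]]) (simp add: T(1) T'(1))
qed

lemma transitive_fibre_triples: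
  assumes "T \<in> fibre_triples doubled_points" "T' \<in> fibre_triples doubled_points"
  shows "\<exists>h\<in>doubled_group. h ` T = T'"
proof -
  obtain a b i where T: "T = {(a, False), (a, True), (b, i)}" "a \<noteq> b" "T \<subseteq> doubled_points"
    using assms(1) by (rule fibre_tripleE)
  obtain a' b' j where T': "T' = {(a', False), (a', True), (b', j)}" "a' \<noteq> b'" "T' \<subseteq> doubled_points"
    using assms(2) by (rule fibre_tripleE)
  obtain s where s: "s \<in> {id, Not}" "s i = j" "s (\<not> i) = (\<not> j)"
    using ex_level_map[of i j] by blast
  obtain g where g: "g \<in> G" "g a = a'" "g b = b'"
    using transitive_pairs[OF T(2) _ T'(2)] T(1,3) T'(1,3) by (auto simp: doubled_points_def)
  have "{s False, s True} = {False, True}"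
    using s(1) by auto
  then have "map_prod g s ` T = T'"
    using g s by (auto simp: T(1) T'(1) doubleton_eq_iff)
  then show ?thesis
    using doubled_groupI[OF g(1) s(1)] by blast
qed

lemma finite_doubled_points: "finite doubled_points"
  by (simp add: doubled_points_def finite_points)

text \<open>
  The third cardinality is the group order because a mixed triple amounts to a level, one point on
  that level, and an unordered pair of further points for the other level.
\<close>
lemma card_triple_orbits:
  shows "card (level_triples doubled_points) = 2 * (card P choose 3)"
    and "card (fibre_triples doubled_points) = card P * (2 * card P - 2)"
    and "card (mixed_triples doubled_points) = card G"
proof -
  have sec: "{p. (p, i) \<in> doubled_points} = P" for i
    by (auto simp: doubled_points_def)
  have card: "card doubled_points = 2 * card P"
    by (simp add: doubled_points_def card_cartesian_product)
  show 1: "card (level_triples doubled_points) = 2 * (card P choose 3)"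
    using card_level_triples[OF finite_doubled_points] by (simp add: sec)
  have "{p. (p, False) \<in> doubled_points \<and> (p, True) \<in> doubled_points} = P"
    by (auto simp: doubled_points_def)
  then show 2: "card (fibre_triples doubled_points) = card P * (2 * card P - 2)"
    using card_fibre_triples[OF finite_doubled_points] by (simp add: card)
  show "card (mixed_triples doubled_points) = card G"
  proof -
    obtain m where m: "card P = m + 3"
      using three_points le_Suc_ex by (metis add.commute)
    define M where "M = card (mixed_triples doubled_points)"
    define c where "c = card P choose 3"
    define d where "d = 2 * card P choose 3"
    have "6 * c = (m + 3) * (m + 2) * (m + 1)" "6 * d = (2 * m + 6) * (2 * m + 5) * (2 * m + 4)"
      unfolding c_def d_def six_times_choose_3 m by (simp_all add: algebra_simps)
    moreover have "2 * c + (m + 3) * (2 * m + 4) + M = d"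
      using card_mixed_triples[OF finite_doubled_points] unfolding 1 2 card c_def d_def M_def
      by (simp add: m add.commute)
    ultimately have "M = (m + 3) * (m + 2) * (m + 1)"
      by (simp add: algebra_simps)
    then show ?thesis
      by (simp add: card_group m M_def)
  qed
qed

section \<open>Invariant families of split blocks\<close>

text \<open>
  Triviality of the stabiliser of a split block, expressed on the undoubled points.
\<close>
definition regular_pair :: "'p set \<Rightarrow> 'p set \<Rightarrow> bool" where
  "regular_pair A B \<longleftrightarrow> (\<forall>g\<in>G. g ` A = A \<longrightarrow> g ` B = B \<longrightarrow> g = id)"

lemma image_split_block:
  assumes "s \<in> {id, Not}"
  shows "map_prod g s ` split_block i A B = split_block (s i) (g ` A) (g ` B)"
proof -
  have "s (\<not> i) = (\<not> s i)"
    using assms by auto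
  moreover have "map_prod g s ` (C \<times> {j}) = g ` C \<times> {s j}" for C j
    by force
  ultimately show ?thesis
    by (simp add: split_block_def image_Un)
qed

lemma group_image:
  assumes "g \<in> G"
  shows "A \<subseteq> P \<Longrightarrow> g ` A \<subseteq> P" "card (g ` A) = card A" "g ` (A \<inter> B) = g ` A \<inter> g ` B"
proof -
  have "inj g"
    by (rule perm_group_inj[OF group assms])
  then show "card (g ` A) = card A" "g ` (A \<inter> B) = g ` A \<inter> g ` B"
    by (simp_all add: card_image inj_on_subset image_Int)
  show "g ` A \<subseteq> P" if "A \<subseteq> P"
    using that maps_points[OF assms] by blast
qed

lemma regular_split_block:
  assumes "regular_pair A B" "card A \<noteq> card B"
  shows "regular_in doubled_group (split_block i A B)"
  unfolding regular_in_def
proof (intro ballI impI)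
  fix h assume "h \<in> doubled_group" and fixed: "h ` split_block i A B = split_block i A B"
  then obtain g s where h: "h = map_prod g s" "g \<in> G" "s \<in> {id, Not}"
    by (metis doubled_groupE)
  have "split_block i A B = split_block (s i) (g ` A) (g ` B)"
    using fixed by (simp add: h(1) image_split_block[OF h(3)])
  then have eq: "i = s i \<and> A = g ` A \<and> B = g ` B"
    by (rule split_block_inject) (use assms(2) group_image(2)[OF h(2)] in simp)
  then have "g = id"
    using assms(1) h(2) by (metis regular_pair_def)
  moreover have "s = id"
    using eq h(3) by auto
  ultimately show "h = id"
    by (simp add: h(1) map_prod.id)
qed

text \<open>
  Since each pair yields two blocks, one for each choice of levels, and the doubled group is twice
  as large, the sufficient number of regular pairs is \<open>m * card G\<close>.
\<close>
lemma regular_split_block_family: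
  assumes pairs: "\<P> \<subseteq> {(A, B). A \<subseteq> P \<and> B \<subseteq> P \<and> card A = k \<and> card B = l}" and "k \<noteq> l"
    and inv: "\<And>g A B. g \<in> G \<Longrightarrow> (A, B) \<in> \<P> \<Longrightarrow> (g ` A, g ` B) \<in> \<P>"
    and enough: "m * card G \<le> card {(A, B) \<in> \<P>. regular_pair A B}"
  shows "\<exists>F. F \<subseteq> {split_block i A B |i A B. (A, B) \<in> \<P>} \<and> finite F \<and>
    invariant_under doubled_group F \<and> card F = 2 * m * card G"
proof -
  define \<Omega> where "\<Omega> = {split_block i A B |i A B. (A, B) \<in> \<P>}"
  define R where "R = {(A, B) \<in> \<P>. regular_pair A B}"
  define \<beta> where "\<beta> = (\<lambda>(i, A, B). split_block i A B :: ('p \<times> bool) set)"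
  have sizes: "card A = k \<and> card B = l" if "(A, B) \<in> \<P>" for A B
    using pairs that by blast
  have "\<P> \<subseteq> Pow P \<times> Pow P"
    using pairs by auto
  then have fin: "finite \<P>"
    by (rule finite_subset) (simp add: finite_points)
  have "invariant_under doubled_group \<Omega>"
    unfolding invariant_under_def
  proof (intro ballI)
    fix h X assume "h \<in> doubled_group" "X \<in> \<Omega>"
    obtain g s where h: "h = map_prod g s" "g \<in> G" "s \<in> {id, Not}"
      using \<open>h \<in> doubled_group\<close> by (rule doubled_groupE)
    obtain i A B where X: "X = split_block i A B" "(A, B) \<in> \<P>"
      using \<open>X \<in> \<Omega>\<close> unfolding \<Omega>_def by blast
    have "h ` X = split_block (s i) (g ` A) (g ` B)"
      by (simp only: h(1) X(1) image_split_block[OF h(3)])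
    then show "h ` X \<in> \<Omega>"
      unfolding \<Omega>_def using inv[OF h(2) X(2)] by blast
  qed
  moreover have "m * card doubled_group \<le> card {B \<in> \<Omega>. regular_in doubled_group B}"
  proof -
    have "inj_on \<beta> (UNIV \<times> R)"
    proof (rule inj_onI)
      fix x y assume xy: "x \<in> UNIV \<times> R" "y \<in> UNIV \<times> R" "\<beta> x = \<beta> y"
      obtain i A B where x: "x = (i, A, B)"
        by (rule prod_cases3)
      obtain j A' B' where y: "y = (j, A', B')"
        by (rule prod_cases3)
      have "split_block i A B = split_block j A' B'" "card A \<noteq> card B'"
        using xy sizes[of A B] sizes[of A' B'] \<open>k \<noteq> l\<close> by (simp_all add: x y \<beta>_def R_def)
      then have "i = j \<and> A = A' \<and> B = B'"
        by (rule split_block_inject)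
      then show "x = y"
        by (simp add: x y)
    qed
    then have "card (\<beta> ` (UNIV \<times> R)) = 2 * card R"
      by (simp add: card_image card_cartesian_product)
    moreover have "\<beta> ` (UNIV \<times> R) \<subseteq> {B \<in> \<Omega>. regular_in doubled_group B}"
    proof (rule image_subsetI)
      fix x assume "x \<in> (UNIV :: bool set) \<times> R"
      then obtain i A B where x: "x = (i, A, B)" "(A, B) \<in> \<P>" "regular_pair A B"
        by (auto simp: R_def)
      then have "card A \<noteq> card B"
        using sizes \<open>k \<noteq> l\<close> by simp
      then show "\<beta> x \<in> {B \<in> \<Omega>. regular_in doubled_group B}"
        using regular_split_block x by (auto simp: \<beta>_def \<Omega>_def)
    qed
    moreover have "finite \<Omega>"
    proof -
      have "\<Omega> = \<beta> ` (UNIV \<times> \<P>)"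
        by (force simp: \<Omega>_def \<beta>_def)
      then show ?thesis
        using fin by simp
    qed
    ultimately have "2 * card R \<le> card {B \<in> \<Omega>. regular_in doubled_group B}"
      using card_mono[of "{B \<in> \<Omega>. regular_in doubled_group B}" "\<beta> ` (UNIV \<times> R)"] by simp
    then show ?thesis
      using enough by (simp add: card_doubled_group R_def)
  qed
  ultimately show ?thesis
    using invariant_subfamily_of_regular_orbits[OF perm_group_doubled finite_doubled_group, of \<Omega> m]
    by (simp add: card_doubled_group \<Omega>_def mult.commute mult.left_commute)
qed

lemma card_fixed_points:
  assumes "g \<in> G" "g \<noteq> id"
  shows "card {x \<in> P. g x = x} \<le> 2"
proof (rule ccontr)
  assume "\<not> ?thesis"
  then have "3 \<le> card {x \<in> P. g x = x}"
    by simp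
  then obtain T where T: "T \<subseteq> {x \<in> P. g x = x}" "card T = 3"
    by (rule obtain_subset_with_card_n)
  then obtain a b c where abc: "T = {a, b, c}" "a \<noteq> b" "a \<noteq> c" "b \<noteq> c"
    unfolding card_3_iff by blast
  have "g = id"
    by (rule sharp[OF assms(1), of a b c]) (use T(1) abc in auto)
  with assms(2) show False ..
qed

text \<open>
  The bound nine, in place of the true order six, comes from recording only the images of two of the
  points, without excluding that they coincide; it is good enough for the counts that follow.
\<close>
lemma stabiliser_of_three_points:
  assumes "A \<subseteq> P" "card A = 3"
  shows "finite {g \<in> G. g ` A = A}" "card {g \<in> G. g ` A = A} \<le> 9"
proof -
  show "finite {g \<in> G. g ` A = A}"
    using finite_group by simp
  obtain a b c where abc: "A = {a, b, c}" "a \<noteq> b" "a \<noteq> c" "b \<noteq> c"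
    using assms(2) unfolding card_3_iff by blast
  have "inj_on (\<lambda>g. (g a, g b)) {g \<in> G. g ` A = A}"
  proof (rule inj_onI)
    fix g h assume g: "g \<in> {g \<in> G. g ` A = A}" and h: "h \<in> {g \<in> G. g ` A = A}"
      and eq: "(g a, g b) = (h a, h b)"
    have "inj g" "inj h"
      using g h perm_group_inj[OF group] by auto
    then have "g c \<notin> {g a, g b}" "h c \<notin> {h a, h b}"
      using abc by (auto dest: injD)
    moreover have "{g a, g b, g c} = {h a, h b, h c}"
      using g h by (simp add: abc(1))
    ultimately have "g c = h c"
      using eq by auto
    then show "g = h"
      using unique_on_triples[of g h a b c] g h eq abc assms(1) by simp
  qed
  moreover have "(\<lambda>g. (g a, g b)) ` {g \<in> G. g ` A = A} \<subseteq> A \<times> A"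
    using abc(1) by blast
  moreover have "finite A"
    by (simp add: abc(1))
  ultimately have "card {g \<in> G. g ` A = A} \<le> card (A \<times> A)"
    by (intro card_inj_on_le) auto
  then show "card {g \<in> G. g ` A = A} \<le> 9"
    by (simp add: card_cartesian_product assms(2))
qed

text \<open>
  An element that preserves a pair either fixes both of its points, and then the pair is its full
  set of fixed points, or it exchanges them, and then one point of the pair determines the other.
\<close>
lemma irregular_pairs:
  assumes A: "A \<subseteq> P" "card A = 3" and B: "B \<subseteq> P" "card B = 2" and "\<not> regular_pair A B"
  obtains g where "g \<in> G" "g ` A = A" "g \<noteq> id" "g ` B = B"
    "B = {x \<in> P. g x = x} \<or> (\<forall>x\<in>B. g x \<noteq> x \<and> B = {x, g x})"
proof -
  obtain g where g: "g \<in> G" "g ` A = A" "g \<noteq> id" "g ` B = B"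
    using assms(5) by (auto simp: regular_pair_def)
  obtain d e where de: "B = {d, e}" "d \<noteq> e"
    using B(2) by (auto simp: card_2_iff)
  show ?thesis
  proof (cases "g d = d")
    case True
    then have "g e = e"
      using g(4) perm_group_inj[OF group g(1)] de by (auto dest: injD simp: doubleton_eq_iff)
    then have "B \<subseteq> {x \<in> P. g x = x}"
      using True B(1) de by auto
    moreover have "card {x \<in> P. g x = x} \<le> card B"
      using card_fixed_points[OF g(1,3)] B(2) by simp
    ultimately have "B = {x \<in> P. g x = x}"
      using finite_points by (intro card_seteq) auto
    then show ?thesis
      using that g by blast
  next
    case False
    then have "g d = e" "g e = d"
      using g(4) de by (auto simp: doubleton_eq_iff)
    then show ?thesis
      using that[OF g] de by auto
  qed
qed

text \<open>
  Each of the at most nine elements stabilising \<open>A\<close> spoils one pair of fixed points and at most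
  \<open>card P - 3\<close> pairs of the form \<open>{d, g d}\<close>.
\<close>
lemma irregular_disjoint_pairs:
  assumes A: "A \<subseteq> P" "card A = 3"
  shows "card {B. B \<subseteq> P \<and> card B = 2 \<and> card (A \<inter> B) = 0 \<and> \<not> regular_pair A B} \<le> 9 * (card P - 2)"
proof -
  define S where "S = {g \<in> G. g ` A = A}"
  have finS: "finite S"
    unfolding S_def by (rule stabiliser_of_three_points(1)[OF A])
  have cardS: "card S \<le> 9"
    unfolding S_def by (rule stabiliser_of_three_points(2)[OF A])
  define Bad where "Bad = {B. B \<subseteq> P \<and> card B = 2 \<and> card (A \<inter> B) = 0 \<and> \<not> regular_pair A B}"
  define U where "U = (\<lambda>(g, d). {d, g d}) ` (S \<times> (P - A))"
  define V where "V = (\<lambda>g. {x \<in> P. g x = x}) ` S"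
  have "Bad \<subseteq> U \<union> V"
  proof
    fix B assume "B \<in> Bad"
    then have B: "B \<subseteq> P" "card B = 2" "card (A \<inter> B) = 0" "\<not> regular_pair A B"
      by (simp_all add: Bad_def)
    obtain g where g: "g \<in> G" "g ` A = A" "g \<noteq> id" "g ` B = B"
      "B = {x \<in> P. g x = x} \<or> (\<forall>x\<in>B. g x \<noteq> x \<and> B = {x, g x})"
      by (rule irregular_pairs[OF A B(1,2,4)])
    have "g \<in> S"
      using g by (simp add: S_def)
    have "finite A"
      using A(1) finite_points finite_subset by blast
    then have "A \<inter> B = {}"
      using B(3) by simp
    obtain d where "d \<in> B"
      using B(2) by fastforce
    then have "d \<in> P - A"
      using B(1) \<open>A \<inter> B = {}\<close> by blast
    then show "B \<in> U \<union> V"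
      using g(5) \<open>g \<in> S\<close> \<open>d \<in> B\<close> by (auto simp: U_def V_def)
  qed
  then have "card Bad \<le> card (U \<union> V)"
    by (intro card_mono) (simp_all add: U_def V_def finS finite_points)
  also have "\<dots> \<le> card U + card V"
    by (rule card_Un_le)
  also have "card U \<le> card (S \<times> (P - A))"
    unfolding U_def by (rule card_image_le) (simp add: finS finite_points)
  also have "card (S \<times> (P - A)) = card S * (card P - 3)"
    using A finite_points by (simp add: card_cartesian_product card_Diff_subset finite_subset)
  also have "card V \<le> card S"
    unfolding V_def by (rule card_image_le) (rule finS)
  also have "card S * (card P - 3) + card S = card S * (card P - 2)"
  proof -
    obtain m where "card P = m + 3"
      using three_points le_Suc_ex by (metis add.commute)
    then show ?thesis
      by simp
  qed
  also have "\<dots> \<le> 9 * (card P - 2)"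
    using cardS by simp
  finally show ?thesis
    by (simp add: Bad_def)
qed

text \<open>
  If exactly one point of the pair lies in \<open>A\<close>, an element that stabilises both sets fixes
  that point, hence the other one too: only pairs of fixed points are spoiled.
\<close>
lemma irregular_meeting_pairs:
  assumes A: "A \<subseteq> P" "card A = 3"
  shows "card {B. B \<subseteq> P \<and> card B = 2 \<and> card (A \<inter> B) = 1 \<and> \<not> regular_pair A B} \<le> 9"
proof -
  define S where "S = {g \<in> G. g ` A = A}"
  have finS: "finite S"
    unfolding S_def by (rule stabiliser_of_three_points(1)[OF A])
  have cardS: "card S \<le> 9"
    unfolding S_def by (rule stabiliser_of_three_points(2)[OF A])
  define Bad where "Bad = {B. B \<subseteq> P \<and> card B = 2 \<and> card (A \<inter> B) = 1 \<and> \<not> regular_pair A B}"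
  have "Bad \<subseteq> (\<lambda>g. {x \<in> P. g x = x}) ` S"
  proof
    fix B assume "B \<in> Bad"
    then have B: "B \<subseteq> P" "card B = 2" "card (A \<inter> B) = 1" "\<not> regular_pair A B"
      by (simp_all add: Bad_def)
    obtain g where g: "g \<in> G" "g ` A = A" "g \<noteq> id" "g ` B = B"
      "B = {x \<in> P. g x = x} \<or> (\<forall>x\<in>B. g x \<noteq> x \<and> B = {x, g x})"
      by (rule irregular_pairs[OF A B(1,2,4)])
    obtain p where p: "A \<inter> B = {p}"
      using B(3) by (auto simp: card_1_singleton_iff)
    have "g ` (A \<inter> B) = A \<inter> B"
      using group_image(3)[OF g(1)] g(2,4) by simp
    then have "g p = p" "p \<in> B"
      using p by auto
    then have "B = {x \<in> P. g x = x}"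
      using g(5) by blast
    then show "B \<in> (\<lambda>g. {x \<in> P. g x = x}) ` S"
      using g(1,2) by (simp add: S_def)
  qed
  then have "card Bad \<le> card S"
    using finS surj_card_le by blast
  then show ?thesis
    using cardS by (simp add: Bad_def)
qed

text \<open>
  The factor six arises because \<open>card G\<close> is six times the number of 3-subsets of the points: an orbit
  of regular pairs contributes six pairs over each 3-subset.
\<close>
lemma three_two_family:
  assumes many: "\<And>A. A \<subseteq> P \<Longrightarrow> card A = 3 \<Longrightarrow>
      6 * m \<le> card {B. B \<subseteq> P \<and> card B = 2 \<and> card (A \<inter> B) = \<delta> \<and> regular_pair A B}"
  shows "\<exists>F. F \<subseteq> {split_block i A B |i A B. A \<subseteq> P \<and> B \<subseteq> P \<and> card A = 3 \<and> card B = 2 \<and> card (A \<inter> B) = \<delta>} \<and>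
    finite F \<and> invariant_under doubled_group F \<and> card F = 2 * m * card G"
proof -
  define \<P> where "\<P> = {(A, B). A \<subseteq> P \<and> B \<subseteq> P \<and> card A = 3 \<and> card B = 2 \<and> card (A \<inter> B) = \<delta>}"
  define R where "R = (\<lambda>A. {B. B \<subseteq> P \<and> card B = 2 \<and> card (A \<inter> B) = \<delta> \<and> regular_pair A B})"
  define Q where "Q = {A. A \<subseteq> P \<and> card A = 3}"
  have finR: "finite (R A)" for A
    by (rule finite_subset[of _ "Pow P"]) (auto simp: R_def finite_points)
  have finQ: "finite Q"
    by (rule finite_subset[of _ "Pow P"]) (auto simp: Q_def finite_points)
  have "m * card G = (\<Sum>A\<in>Q. 6 * m)"
    by (simp add: Q_def n_subsets finite_points card_group_choose_3)
  also have "\<dots> \<le> (\<Sum>A\<in>Q. card (R A))"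
    by (rule sum_mono) (use many in \<open>auto simp: Q_def R_def\<close>)
  also have "\<dots> = card (Sigma Q R)"
    using finQ finR by simp
  also have "Sigma Q R = {(A, B) \<in> \<P>. regular_pair A B}"
    by (auto simp: Q_def R_def \<P>_def)
  finally have enough: "m * card G \<le> card {(A, B) \<in> \<P>. regular_pair A B}" .
  have "\<exists>F. F \<subseteq> {split_block i A B |i A B. (A, B) \<in> \<P>} \<and> finite F \<and>
    invariant_under doubled_group F \<and> card F = 2 * m * card G"
  proof (rule regular_split_block_family[OF _ _ _ enough, of 3 2])
    fix g A B assume "g \<in> G" "(A, B) \<in> \<P>"
    then show "(g ` A, g ` B) \<in> \<P>"
      using group_image[of g] by (auto simp: \<P>_def simp flip: group_image(3))
  qed (auto simp: \<P>_def)
  then show ?thesis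
    by (simp add: \<P>_def)
qed

lemma disjoint_three_two_family:
  assumes "33 \<le> card P" "6 * m \<le> 3 * (card P - 7)"
  shows "\<exists>F. F \<subseteq> {split_block i A B |i A B. A \<subseteq> P \<and> B \<subseteq> P \<and> card A = 3 \<and> card B = 2 \<and> card (A \<inter> B) = 0} \<and>
    finite F \<and> invariant_under doubled_group F \<and> card F = 2 * m * card G"
proof (rule three_two_family)
  fix A assume A: "A \<subseteq> P" "card A = 3"
  have finA: "finite A"
    using A(1) finite_points finite_subset by blast
  define R where "R = {B. B \<subseteq> P \<and> card B = 2 \<and> card (A \<inter> B) = 0 \<and> regular_pair A B}"
  define I where "I = {B. B \<subseteq> P \<and> card B = 2 \<and> card (A \<inter> B) = 0 \<and> \<not> regular_pair A B}"
  have "{B. B \<subseteq> P - A \<and> card B = 2} \<subseteq> R \<union> I"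
  proof
    fix B assume B: "B \<in> {B. B \<subseteq> P - A \<and> card B = 2}"
    then have "A \<inter> B = {}"
      by blast
    then show "B \<in> R \<union> I"
      using B by (auto simp: R_def I_def)
  qed
  moreover have "finite R" "finite I"
    by (rule finite_subset[of _ "Pow P"]; auto simp: R_def I_def finite_points)+
  ultimately have "card {B. B \<subseteq> P - A \<and> card B = 2} \<le> card (R \<union> I)"
    by (intro card_mono) simp_all
  then have "card {B. B \<subseteq> P - A \<and> card B = 2} \<le> card R + card I"
    using card_Un_le order_trans by blast
  moreover have "card {B. B \<subseteq> P - A \<and> card B = 2} = (card P - 3 choose 2)"
    using A finA finite_points by (simp add: n_subsets card_Diff_subset)
  moreover have "card I \<le> 9 * (card P - 2)"
    unfolding I_def by (rule irregular_disjoint_pairs[OF A])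
  ultimately have "(card P - 3 choose 2) \<le> card R + 9 * (card P - 2)"
    by simp
  then have "(card P - 3) * (card P - 4) \<le> 2 * card R + 18 * (card P - 2)"
    using choose_2_times_2[of "card P - 3"] by simp
  (* Substituting the smallest admissible size removes all truncated subtractions. *)
  moreover obtain k where k: "card P = k + 33"
    using le_Suc_ex[OF assms(1)] by (metis add.commute)
  ultimately have "(k + 30) * (k + 29) \<le> 2 * card R + 18 * (k + 31)"
    by (simp add: add.commute)
  then have "6 * (k + 26) \<le> 2 * card R"
    by (simp add: algebra_simps)
  then have "6 * m \<le> card R"
    using assms(2) by (simp add: k)
  then show "6 * m \<le> card {B. B \<subseteq> P \<and> card B = 2 \<and> card (A \<inter> B) = 0 \<and> regular_pair A B}"
    by (simp add: R_def)
qed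

lemma meeting_three_two_family:
  assumes "9 + 6 * m \<le> 3 * (card P - 3)"
  shows "\<exists>F. F \<subseteq> {split_block i A B |i A B. A \<subseteq> P \<and> B \<subseteq> P \<and> card A = 3 \<and> card B = 2 \<and> card (A \<inter> B) = 1} \<and>
    finite F \<and> invariant_under doubled_group F \<and> card F = 2 * m * card G"
proof (rule three_two_family)
  fix A assume A: "A \<subseteq> P" "card A = 3"
  have finA: "finite A"
    using A(1) finite_points finite_subset by blast
  define R where "R = {B. B \<subseteq> P \<and> card B = 2 \<and> card (A \<inter> B) = 1 \<and> regular_pair A B}"
  define I where "I = {B. B \<subseteq> P \<and> card B = 2 \<and> card (A \<inter> B) = 1 \<and> \<not> regular_pair A B}"
  define \<pi> where "\<pi> = (\<lambda>(a, d). {a, d :: 'p})"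
  have "inj_on \<pi> (A \<times> (P - A))"
    by (auto simp: inj_on_def \<pi>_def doubleton_eq_iff)
  then have "card (\<pi> ` (A \<times> (P - A))) = 3 * (card P - 3)"
    using A finA finite_points by (simp add: card_image card_cartesian_product card_Diff_subset)
  moreover have "\<pi> ` (A \<times> (P - A)) \<subseteq> R \<union> I"
  proof (rule image_subsetI)
    fix x assume "x \<in> A \<times> (P - A)"
    then obtain a d where x: "x = (a, d)" "a \<in> A" "d \<in> P" "d \<notin> A"
      by blast
    then have "A \<inter> \<pi> x = {a}" "card (\<pi> x) = 2" "\<pi> x \<subseteq> P"
      using A(1) by (auto simp: \<pi>_def card_insert_if)
    then show "\<pi> x \<in> R \<union> I"
      by (simp add: R_def I_def)
  qed
  moreover have "finite R" "finite I"
    by (rule finite_subset[of _ "Pow P"]; auto simp: R_def I_def finite_points)+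
  ultimately have "3 * (card P - 3) \<le> card (R \<union> I)"
    using card_mono[of "R \<union> I" "\<pi> ` (A \<times> (P - A))"] by simp
  then have "3 * (card P - 3) \<le> card R + card I"
    using card_Un_le order_trans by blast
  moreover have "card I \<le> 9"
    unfolding I_def by (rule irregular_meeting_pairs[OF A])
  ultimately have "6 * m \<le> card R"
    using assms by simp
  then show "6 * m \<le> card {B. B \<subseteq> P \<and> card B = 2 \<and> card (A \<inter> B) = 1 \<and> regular_pair A B}"
    by (simp add: R_def)
qed

text \<open>
  If the pair lies inside the triple, the family of all such blocks already has the required size:
  there are two choices of levels, and three pairs in each 3-subset.
\<close>
lemma nested_three_two_family:
  shows "\<exists>F. F \<subseteq> {split_block i A B |i A B. A \<subseteq> P \<and> B \<subseteq> P \<and> card A = 3 \<and> card B = 2 \<and> card (A \<inter> B) = 2} \<and>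
    finite F \<and> invariant_under doubled_group F \<and> card F = card G"
proof -
  define Q where "Q = {A. A \<subseteq> P \<and> card A = 3}"
  define S where "S = (\<lambda>A. {B. B \<subseteq> A \<and> card B = (2 :: nat)} :: 'p set set)"
  define \<beta> where "\<beta> = (\<lambda>(i, A, B). split_block i A B :: ('p \<times> bool) set)"
  have finQ: "finite Q"
    by (rule finite_subset[of _ "Pow P"]) (auto simp: Q_def finite_points)
  have finA: "finite A" if "A \<in> Q" for A
    using that finite_points finite_subset by (auto simp: Q_def)
  have finS: "finite (S A)" if "A \<in> Q" for A
    by (rule finite_subset[of _ "Pow A"]) (use finA[OF that] in \<open>auto simp: S_def\<close>)
  have "card (S A) = 3" if "A \<in> Q" for A
    using n_subsets[OF finA[OF that], of 2] that by (simp add: S_def Q_def choose_two)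
  then have "card (Sigma Q S) = 3 * card Q"
    using finQ finS by simp
  then have card: "card ((UNIV :: bool set) \<times> Sigma Q S) = card G"
    by (simp add: card_cartesian_product Q_def n_subsets finite_points card_group_choose_3)
  have "inj_on \<beta> (UNIV \<times> Sigma Q S)"
  proof (rule inj_onI)
    fix x y assume xy: "x \<in> UNIV \<times> Sigma Q S" "y \<in> UNIV \<times> Sigma Q S" "\<beta> x = \<beta> y"
    obtain i A B where x: "x = (i, A, B)"
      by (rule prod_cases3)
    obtain j A' B' where y: "y = (j, A', B')"
      by (rule prod_cases3)
    have "split_block i A B = split_block j A' B'" "card A \<noteq> card B'"
      using xy by (simp_all add: x y \<beta>_def Q_def S_def)
    then have "i = j \<and> A = A' \<and> B = B'"
      by (rule split_block_inject)
    then show "x = y"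
      by (simp add: x y)
  qed
  then have "card (\<beta> ` (UNIV \<times> Sigma Q S)) = card G"
    using card by (simp add: card_image)
  moreover have "finite (\<beta> ` (UNIV \<times> Sigma Q S))"
    using finQ finS by auto
  moreover have "\<beta> ` (UNIV \<times> Sigma Q S) \<subseteq>
    {split_block i A B |i A B. A \<subseteq> P \<and> B \<subseteq> P \<and> card A = 3 \<and> card B = 2 \<and> card (A \<inter> B) = 2}"
  proof (rule image_subsetI)
    fix x assume xm: "x \<in> (UNIV :: bool set) \<times> Sigma Q S"
    obtain i A B where x: "x = (i, A, B)"
      by (rule prod_cases3)
    have "A \<subseteq> P" "card A = 3" "B \<subseteq> A" "card B = 2"
      using xm by (simp_all add: x Q_def S_def)
    moreover from this have "A \<inter> B = B" "B \<subseteq> P"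
      by blast+
    ultimately have "A \<subseteq> P \<and> B \<subseteq> P \<and> card A = 3 \<and> card B = 2 \<and> card (A \<inter> B) = 2"
      by simp
    moreover have "\<beta> x = split_block i A B"
      by (simp add: \<beta>_def x)
    ultimately show "\<beta> x \<in> {split_block i A B |i A B. A \<subseteq> P \<and> B \<subseteq> P \<and> card A = 3 \<and> card B = 2 \<and> card (A \<inter> B) = 2}"
      by blast
  qed
  moreover have "invariant_under doubled_group (\<beta> ` (UNIV \<times> Sigma Q S))"
    unfolding invariant_under_def
  proof (intro ballI)
    fix h X assume "h \<in> doubled_group" "X \<in> \<beta> ` (UNIV \<times> Sigma Q S)"
    obtain g s where h: "h = map_prod g s" "g \<in> G" "s \<in> {id, Not}"
      using \<open>h \<in> doubled_group\<close> by (rule doubled_groupE)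
    obtain x where xm: "x \<in> UNIV \<times> Sigma Q S" "X = \<beta> x"
      using \<open>X \<in> _\<close> by blast
    obtain i A B where x: "x = (i, A, B)"
      by (rule prod_cases3)
    have AB: "A \<subseteq> P" "card A = 3" "B \<subseteq> A" "card B = 2"
      using xm(1) by (simp_all add: x Q_def S_def)
    have "g ` B \<subseteq> g ` A"
      using AB(3) by blast
    then have "(s i, g ` A, g ` B) \<in> UNIV \<times> Sigma Q S"
      using group_image[OF h(2)] AB by (simp add: Q_def S_def)
    moreover have "h ` X = \<beta> (s i, g ` A, g ` B)"
      by (simp add: xm(2) x \<beta>_def h(1) image_split_block[OF h(3)])
    ultimately show "h ` X \<in> \<beta> ` (UNIV \<times> Sigma Q S)"
      by blast
  qed
  ultimately show ?thesis
    by blast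
qed

text \<open>
  For each point \<open>e\<close>, every 4-set preserved by a non-identity element that fixes \<open>e\<close> contains a
  point determined by the other three. For the projective line in characteristic two, \<open>\<beta>\<close> adds up
  these three points on the affine line that remains after removing \<open>e\<close>.
\<close>
definition has_barycentres :: bool where
  "has_barycentres \<longleftrightarrow> (\<forall>e\<in>P. \<exists>\<beta>. \<forall>A\<subseteq>P - {e}. card A = 4 \<longrightarrow> \<not> regular_pair A {e} \<longrightarrow>
     (\<exists>x\<in>A. x = \<beta> (A - {x})))"

text \<open>
  Deleting the determined point maps the spoiled 4-sets injectively to 3-sets.
\<close>
lemma irregular_four_one:
  assumes "has_barycentres" "e \<in> P"
  shows "card {A. A \<subseteq> P - {e} \<and> card A = 4 \<and> \<not> regular_pair A {e}} \<le> (card P - 1 choose 3)"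
proof -
  define I where "I = {A. A \<subseteq> P - {e} \<and> card A = 4 \<and> \<not> regular_pair A {e}}"
  obtain \<beta> where "\<forall>A\<subseteq>P - {e}. card A = 4 \<longrightarrow> \<not> regular_pair A {e} \<longrightarrow> (\<exists>x\<in>A. x = \<beta> (A - {x}))"
    using assms by (auto simp: has_barycentres_def)
  then have "\<forall>A\<in>I. \<exists>x. x \<in> A \<and> x = \<beta> (A - {x})"
    by (simp add: I_def Bex_def)
  then obtain x where x: "\<forall>A\<in>I. x A \<in> A \<and> x A = \<beta> (A - {x A})"
    by (rule bchoice[THEN exE])
  have "inj_on (\<lambda>A. A - {x A}) I"
  proof (rule inj_onI)
    fix A B assume AB: "A \<in> I" "B \<in> I" "A - {x A} = B - {x B}"
    have "x A = \<beta> (A - {x A})" "x B = \<beta> (B - {x B})" "x A \<in> A" "x B \<in> B"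
      using AB(1,2) x by blast+
    then have "x A = x B"
      using AB(3) by simp
    then have "insert (x A) (A - {x A}) = insert (x B) (B - {x B})"
      using AB(3) by simp
    then show "A = B"
      using \<open>x A \<in> A\<close> \<open>x B \<in> B\<close> by (simp add: insert_absorb)
  qed
  moreover have "(\<lambda>A. A - {x A}) ` I \<subseteq> {T. T \<subseteq> P - {e} \<and> card T = 3}"
  proof (rule image_subsetI)
    fix A assume "A \<in> I"
    then have "A \<subseteq> P - {e}" "card A = 4" "x A \<in> A"
      using x by (simp_all add: I_def)
    then show "A - {x A} \<in> {T. T \<subseteq> P - {e} \<and> card T = 3}"
      by auto
  qed
  ultimately have "card I \<le> card {T. T \<subseteq> P - {e} \<and> card T = 3}"
    by (rule card_inj_on_le) (rule finite_subset[of _ "Pow P"], auto simp: finite_points)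
  also have "\<dots> = (card P - 1 choose 3)"
    using assms(2) finite_points by (simp add: n_subsets)
  finally show ?thesis
    by (simp add: I_def)
qed

text \<open>
  With \<open>q = card P - 1\<close>, at least \<open>(q choose 4) - (q choose 3)\<close> of the 4-sets remain for each
  single point, and this is \<open>q (q - 1) (q - 2) (q - 7) / 24\<close>.
\<close>
lemma four_one_family:
  assumes "has_barycentres" "8 \<le> card P" "24 * m \<le> (card P - 3) * (card P - 8)"
  shows "\<exists>F. F \<subseteq> {split_block i A B |i A B. A \<subseteq> P \<and> B \<subseteq> P \<and> card A = 4 \<and> card B = 1 \<and> card (A \<inter> B) = 0} \<and>
    finite F \<and> invariant_under doubled_group F \<and> card F = 2 * m * card G"
proof -
  define \<P> where "\<P> = {(A, B). A \<subseteq> P \<and> B \<subseteq> P \<and> card A = 4 \<and> card B = 1 \<and> card (A \<inter> B) = 0}"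
  define R where "R = (\<lambda>e. {A. A \<subseteq> P - {e} \<and> card A = 4 \<and> regular_pair A {e}})"
  define I where "I = (\<lambda>e. {A. A \<subseteq> P - {e} \<and> card A = 4 \<and> \<not> regular_pair A {e}})"
  have finR: "finite (R e)" and finI: "finite (I e)" for e
    by (rule finite_subset[of _ "Pow P"]; auto simp: R_def I_def finite_points)+
  obtain k where k: "card P = k + 8"
    using le_Suc_ex[OF assms(2)] by (metis add.commute)
  have many: "m * ((card P - 1) * (card P - 2)) \<le> card (R e)" if "e \<in> P" for e
  proof -
    have "{A. A \<subseteq> P - {e} \<and> card A = 4} = R e \<union> I e"
      unfolding R_def I_def by blast
    then have "(card P - 1 choose 4) = card (R e \<union> I e)"
      using n_subsets[of "P - {e}" 4] that by (simp add: finite_points)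
    also have "\<dots> \<le> card (R e) + card (I e)"
      by (rule card_Un_le)
    also have "card (I e) \<le> (card P - 1 choose 3)"
      unfolding I_def by (rule irregular_four_one[OF assms(1) that])
    finally have le: "card P - 1 choose 4 \<le> card (R e) + (card P - 1 choose 3)"
      by simp
    define c where "c = card P - 1 choose 3"
    define w where "w = (k + 7) * (k + 6)"
    have "4 * (card P - 1 choose 4) = (k + 4) * c"
      unfolding choose_4_times_4 c_def by (simp add: k)
    then have "(k + 4) * c \<le> 4 * card (R e) + 4 * c"
      using le by (simp add: c_def)
    then have "k * (6 * c) \<le> 24 * card (R e)"
      by (simp add: algebra_simps)
    moreover have "6 * c = (k + 5) * w"
      unfolding six_times_choose_3 w_def c_def by (simp add: k algebra_simps)
    ultimately have "k * ((k + 5) * w) \<le> 24 * card (R e)"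
      by simp
    moreover have "24 * m \<le> (k + 5) * k"
      using assms(3) by (simp add: k add.commute)
    then have "24 * m * w \<le> (k + 5) * k * w"
      by (rule mult_le_mono1)
    ultimately have "m * w \<le> card (R e)"
      by (simp add: algebra_simps)
    then show ?thesis
      by (simp add: k w_def add.commute)
  qed
  have "m * card G = (\<Sum>e\<in>P. m * ((card P - 1) * (card P - 2)))"
    by (simp add: card_group mult_ac)
  also have "\<dots> \<le> (\<Sum>e\<in>P. card (R e))"
    by (rule sum_mono) (rule many)
  also have "\<dots> = card (Sigma P R)"
    using finite_points finR by simp
  also have "\<dots> \<le> card {(A, B) \<in> \<P>. regular_pair A B}"
  proof (rule card_inj_on_le[of "\<lambda>(e, A). (A, {e})"])
    show "inj_on (\<lambda>(e, A). (A, {e})) (Sigma P R)"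
      by (auto simp: inj_on_def)
    show "(\<lambda>(e, A). (A, {e})) ` Sigma P R \<subseteq> {(A, B) \<in> \<P>. regular_pair A B}"
    proof (rule image_subsetI)
      fix x assume xm: "x \<in> Sigma P R"
      obtain e A where x: "x = (e, A)"
        by (rule prod.exhaust)
      have "e \<in> P" "A \<subseteq> P - {e}" "card A = 4" "regular_pair A {e}"
        using xm by (simp_all add: x R_def)
      moreover from this(2) have "A \<inter> {e} = {}" "A \<subseteq> P"
        by blast+
      ultimately show "(\<lambda>(e, A). (A, {e})) x \<in> {(A, B) \<in> \<P>. regular_pair A B}"
        by (simp add: x \<P>_def)
    qed
    have "{(A, B) \<in> \<P>. regular_pair A B} \<subseteq> Pow P \<times> Pow P"
      by (auto simp: \<P>_def)
    then show "finite {(A, B) \<in> \<P>. regular_pair A B}"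
      by (rule finite_subset) (simp add: finite_points)
  qed
  finally have enough: "m * card G \<le> card {(A, B) \<in> \<P>. regular_pair A B}" .
  have "\<exists>F. F \<subseteq> {split_block i A B |i A B. (A, B) \<in> \<P>} \<and> finite F \<and>
    invariant_under doubled_group F \<and> card F = 2 * m * card G"
  proof (rule regular_split_block_family[OF _ _ _ enough, of 4 1])
    fix g A B assume "g \<in> G" "(A, B) \<in> \<P>"
    then show "(g ` A, g ` B) \<in> \<P>"
      using group_image[of g] by (auto simp: \<P>_def simp flip: group_image(3))
  qed (auto simp: \<P>_def)
  then show ?thesis
    by (simp add: \<P>_def)
qed

section \<open>The design of a sharply 3-transitive group with barycentres\<close>

lemma split_block_subset: "A \<subseteq> P \<Longrightarrow> B \<subseteq> P \<Longrightarrow> split_block i A B \<subseteq> doubled_points"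
  by (auto simp: split_block_def doubled_points_def)

lemma triple_counts_of_family:
  assumes F: "F \<subseteq> {split_block i A B |i A B. A \<subseteq> P \<and> B \<subseteq> P \<and> card A = k \<and> card B = l \<and> card (A \<inter> B) = \<delta>}"
    and "k + l = 5" and "X \<in> F"
  shows "X \<subseteq> doubled_points" "card X = 5"
    and "card (level_triples X) = (k choose 3) + (l choose 3)"
    and "card (fibre_triples X) = 3 * \<delta>"
    and "card (mixed_triples X) = 10 - ((k choose 3) + (l choose 3)) - 3 * \<delta>"
proof -
  obtain i A B where X: "X = split_block i A B" and AB: "A \<subseteq> P" "B \<subseteq> P" "card A = k" "card B = l" "card (A \<inter> B) = \<delta>"
    using F \<open>X \<in> F\<close> by blast
  have fin: "finite A" "finite B"
    using AB(1,2) finite_points by (auto intro: finite_subset)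
  show "X \<subseteq> doubled_points"
    unfolding X by (rule split_block_subset[OF AB(1,2)])
  show 5: "card X = 5"
    using fin assms(2) by (simp add: X card_split_block AB)
  show 1: "card (level_triples X) = (k choose 3) + (l choose 3)"
    using triples_of_split_block(1)[OF fin] by (simp add: X AB)
  have "k + l - 2 = 3"
    using assms(2) by simp
  then show 2: "card (fibre_triples X) = 3 * \<delta>"
    using triples_of_split_block(2)[OF fin] by (simp add: X AB)
  have "(5 choose 3 :: nat) = 10"
    by (simp add: numeral_eq_Suc)
  moreover have "finite X"
    using fin by (simp add: X)
  ultimately show "card (mixed_triples X) = 10 - ((k choose 3) + (l choose 3)) - 3 * \<delta>"
    using card_mixed_triples[of X] by (simp add: 5 1 2)
qed

text \<open>
  Here \<open>2 * r\<close> is \<open>q\<close>. The four families have pairwise different numbers of level or fibre triples in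
  their blocks, which makes them disjoint, and the totals for the three orbits of triples agree.
\<close>
theorem ex_simple_3_design:
  assumes bary: "has_barycentres" and card: "card P = 2 * r + 1" and r: "16 \<le> r"
  shows "\<exists>F. finite F \<and> (\<forall>B\<in>F. B \<subseteq> doubled_points \<and> card B = 5) \<and>
    (\<forall>T\<subseteq>doubled_points. card T = 3 \<longrightarrow> card {B \<in> F. T \<subseteq> B} = 15 * (2 * r - 1))"
proof -
  define N where "N = card G"
  obtain k where k: "r = k + 16"
    using le_Suc_ex[OF r] by (metis add.commute)
  have "24 * (r - 1) \<le> (card P - 3) * (card P - 8)"
    by (simp add: card k algebra_simps)
  moreover have "8 \<le> card P"
    using card r by simp
  ultimately obtain F1 where F1: "F1 \<subseteq> {split_block i A B |i A B. A \<subseteq> P \<and> B \<subseteq> P \<and> card A = 4 \<and> card B = 1 \<and> card (A \<inter> B) = 0}"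
    "finite F1" "invariant_under doubled_group F1" "card F1 = 2 * (r - 1) * N"
    using four_one_family[OF bary, of "r - 1"] unfolding N_def by blast
  have "33 \<le> card P" "6 * (r - 3) \<le> 3 * (card P - 7)"
    using card r by simp_all
  then obtain F2 where F2: "F2 \<subseteq> {split_block i A B |i A B. A \<subseteq> P \<and> B \<subseteq> P \<and> card A = 3 \<and> card B = 2 \<and> card (A \<inter> B) = 0}"
    "finite F2" "invariant_under doubled_group F2" "card F2 = 2 * (r - 3) * N"
    using disjoint_three_two_family[of "r - 3"] unfolding N_def by blast
  have "9 + 6 * 4 \<le> 3 * (card P - 3)"
    using card r by simp
  then obtain F3 where F3: "F3 \<subseteq> {split_block i A B |i A B. A \<subseteq> P \<and> B \<subseteq> P \<and> card A = 3 \<and> card B = 2 \<and> card (A \<inter> B) = 1}"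
    "finite F3" "invariant_under doubled_group F3" "card F3 = 2 * 4 * N"
    using meeting_three_two_family[of 4] unfolding N_def by blast
  obtain F4 where F4: "F4 \<subseteq> {split_block i A B |i A B. A \<subseteq> P \<and> B \<subseteq> P \<and> card A = 3 \<and> card B = 2 \<and> card (A \<inter> B) = 2}"
    "finite F4" "invariant_under doubled_group F4" "card F4 = N"
    using nested_three_two_family unfolding N_def by blast
  define F where "F = F1 \<union> F2 \<union> F3 \<union> F4"
  have c3: "(4 choose 3 :: nat) = 4" "(3 choose 3 :: nat) = 1" "(2 choose 3 :: nat) = 0" "(Suc 0 choose 3) = 0"
    by (simp_all add: numeral_eq_Suc)
  note t1 = triple_counts_of_family[OF F1(1), simplified, unfolded c3]
  note t2 = triple_counts_of_family[OF F2(1), simplified, unfolded c3]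
  note t3 = triple_counts_of_family[OF F3(1), simplified, unfolded c3]
  note t4 = triple_counts_of_family[OF F4(1), simplified, unfolded c3]
  have d1: "F1 \<inter> F2 = {}"
  proof (intro equals0I)
    fix X assume "X \<in> F1 \<inter> F2"
    then show False
      using t1(3)[of X] t2(3)[of X] by simp
  qed
  have d2: "(F1 \<union> F2) \<inter> F3 = {}"
  proof (intro equals0I)
    fix X assume "X \<in> (F1 \<union> F2) \<inter> F3"
    then show False
      using t1(4)[of X] t2(4)[of X] t3(4)[of X] by auto
  qed
  have d3: "(F1 \<union> F2 \<union> F3) \<inter> F4 = {}"
  proof (intro equals0I)
    fix X assume "X \<in> (F1 \<union> F2 \<union> F3) \<inter> F4"
    then show False
      using t1(4)[of X] t2(4)[of X] t3(4)[of X] t4(4)[of X] by auto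
  qed
  have finF: "finite F"
    using F1(2) F2(2) F3(2) F4(2) by (simp add: F_def)
  have invF: "invariant_under doubled_group F"
    using F1(3) F2(3) F3(3) F4(3) by (auto simp: F_def invariant_under_def)
  have blocks: "B \<subseteq> doubled_points \<and> card B = 5" if "B \<in> F" for B
    using that t1(1,2)[of B] t2(1,2)[of B] t3(1,2)[of B] t4(1,2)[of B] by (auto simp: F_def)
  have sum_F: "(\<Sum>B\<in>F. w B) = 2 * (r - 1) * N * w1 + 2 * (r - 3) * N * w2 + 2 * 4 * N * w3 + N * w4"
    if "\<And>B. B \<in> F1 \<Longrightarrow> w B = w1" "\<And>B. B \<in> F2 \<Longrightarrow> w B = w2"
      "\<And>B. B \<in> F3 \<Longrightarrow> w B = w3" "\<And>B. B \<in> F4 \<Longrightarrow> w B = w4"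
    for w :: "('p \<times> bool) set \<Rightarrow> nat" and w1 w2 w3 w4
  proof -
    have "sum w F = sum w F1 + sum w F2 + sum w F3 + sum w F4"
      unfolding F_def using F1(2) F2(2) F3(2) F4(2) d1 d2 d3
      by (simp add: sum.union_disjoint)
    also have "sum w F1 = card F1 * w1"
      using that(1) by simp
    also have "sum w F2 = card F2 * w2"
      using that(2) by simp
    also have "sum w F3 = card F3 * w3"
      using that(3) by simp
    also have "sum w F4 = card F4 * w4"
      using that(4) by simp
    finally show ?thesis
      by (simp add: F1(4) F2(4) F3(4) F4(4))
  qed
  have finO: "finite {T \<in> Pow doubled_points. Q T}" for Q
    by (simp add: finite_doubled_points)
  have N: "N = (2 * r + 1) * (2 * r) * (2 * r - 1)"
    using card_group by (simp add: N_def card)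
  have "N > 0"
    using r by (simp add: N)
  have "card {B \<in> F. T \<subseteq> B} = 15 * (2 * r - 1)" if T: "T \<subseteq> doubled_points" "card T = 3" for T
  proof -
    consider "T \<in> level_triples doubled_points" | "T \<in> fibre_triples doubled_points"
      | "T \<in> mixed_triples doubled_points"
      using T by (auto simp: mixed_triples_def)
    then show ?thesis
    proof cases
      case 1
      have fin: "finite (level_triples doubled_points)"
        by (rule finite_subset[OF _ finO[of "\<lambda>T. True"]]) (auto simp: level_triples_def)
      have eq: "{T \<in> level_triples doubled_points. T \<subseteq> B} = level_triples B" if "B \<in> F" for B
        using blocks[OF that] by (auto simp: level_triples_def)
      have "card {B \<in> F. T \<subseteq> B} * (2 * (card P choose 3)) = (\<Sum>B\<in>F. card (level_triples B))"
        using count_on_transitive_family[OF perm_group_doubled fin finF invF transitive_level_triples 1]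
        by (simp add: card_triple_orbits eq)
      also have "\<dots> = 2 * (r - 1) * N * 4 + 2 * (r - 3) * N * 1 + 2 * 4 * N * 1 + N * 1"
        by (rule sum_F) (use t1 t2 t3 t4 in simp_all)
      also have "\<dots> = N * (10 * r - 5)"
        by (simp add: k algebra_simps)
      finally have "card {B \<in> F. T \<subseteq> B} * N = N * (10 * r - 5) * 3"
        using card_group_choose_3 by (simp add: N_def)
      then have "card {B \<in> F. T \<subseteq> B} = (10 * r - 5) * 3"
        using \<open>N > 0\<close> by (simp add: mult_ac)
      then show ?thesis
        by (simp add: k)
    next
      case 2
      have fin: "finite (fibre_triples doubled_points)"
        by (rule finite_subset[OF _ finO[of "\<lambda>T. True"]]) (auto simp: fibre_triples_def)
      have eq: "{T \<in> fibre_triples doubled_points. T \<subseteq> B} = fibre_triples B" if "B \<in> F" for B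
        using blocks[OF that] by (auto simp: fibre_triples_def)
      have "card {B \<in> F. T \<subseteq> B} * (card P * (2 * card P - 2)) = (\<Sum>B\<in>F. card (fibre_triples B))"
        using count_on_transitive_family[OF perm_group_doubled fin finF invF transitive_fibre_triples 2]
        by (simp add: card_triple_orbits eq)
      also have "\<dots> = 2 * (r - 1) * N * 0 + 2 * (r - 3) * N * 0 + 2 * 4 * N * 3 + N * 6"
        by (rule sum_F) (use t1 t2 t3 t4 in simp_all)
      also have "\<dots> = 30 * N"
        by simp
      also have "\<dots> = 15 * (2 * r - 1) * (card P * (2 * card P - 2))"
        by (simp add: N card)
      finally show ?thesis
        using card r by simp
    next
      case 3
      have fin: "finite (mixed_triples doubled_points)"
        by (rule finite_subset[OF _ finO[of "\<lambda>T. True"]]) (auto simp: mixed_triples_def)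
      have eq: "{T \<in> mixed_triples doubled_points. T \<subseteq> B} = mixed_triples B" if "B \<in> F" for B
        using blocks[OF that] by (auto simp: mixed_triples_def level_triples_def fibre_triples_def)
      have "card {B \<in> F. T \<subseteq> B} * N = (\<Sum>B\<in>F. card (mixed_triples B))"
        using count_on_transitive_family[OF perm_group_doubled fin finF invF transitive_mixed_triples 3]
        by (simp add: card_triple_orbits eq N_def)
      also have "\<dots> = 2 * (r - 1) * N * 6 + 2 * (r - 3) * N * 9 + 2 * 4 * N * 6 + N * 3"
        by (rule sum_F) (use t1 t2 t3 t4 in simp_all)
      also have "\<dots> = 15 * (2 * r - 1) * N"
        by (simp add: k algebra_simps)
      finally show ?thesis
        using \<open>N > 0\<close> by simp
    qed
  qed
  then show ?thesis
    using finF blocks by (intro exI[of _ F]) simp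
qed

end

section \<open>The projective line over a finite field of characteristic two\<close>

text \<open>The point of the projective line with homogeneous coordinates \<open>(u, v)\<close>.\<close>
definition fraction :: "'a::field \<Rightarrow> 'a \<Rightarrow> 'a option" where
  "fraction u v = (if v = 0 then None else Some (u / v))"

fun moebius :: "'a::field \<Rightarrow> 'a \<Rightarrow> 'a \<Rightarrow> 'a \<Rightarrow> 'a option \<Rightarrow> 'a option" where
  "moebius a b c d None = fraction a c"
| "moebius a b c d (Some x) = fraction (a * x + b) (c * x + d)"

lemma moebius_fraction:
  assumes "a * d - b * c \<noteq> 0" "u \<noteq> 0 \<or> v \<noteq> 0"
  shows "moebius a b c d (fraction u v) = fraction (a * u + b * v) (c * u + d * v)"
proof (cases "v = 0")
  case True
  then show ?thesis
    using assms by (simp add: fraction_def)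
next
  case False
  then have "c * (u / v) + d = (c * u + d * v) / v" "a * (u / v) + b = (a * u + b * v) / v"
    by (simp_all add: field_simps)
  then show ?thesis
    using False by (simp add: fraction_def)
qed

lemma moebius_comp:
  assumes "a * d - b * c \<noteq> 0" "a' * d' - b' * c' \<noteq> 0"
  shows "moebius a b c d \<circ> moebius a' b' c' d' =
    moebius (a * a' + b * c') (a * b' + b * d') (c * a' + d * c') (c * b' + d * d')"
proof
  fix p
  show "(moebius a b c d \<circ> moebius a' b' c' d') p =
    moebius (a * a' + b * c') (a * b' + b * d') (c * a' + d * c') (c * b' + d * d') p"
  proof (cases p)
    case None
    have "a' \<noteq> 0 \<or> c' \<noteq> 0"
      using assms(2) by auto
    then show ?thesis
      by (simp add: None moebius_fraction[OF assms(1)])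
  next
    case (Some x)
    have "a' * x + b' \<noteq> 0 \<or> c' * x + d' \<noteq> 0"
    proof (rule ccontr)
      assume "\<not> ?thesis"
      then have "b' = - (a' * x)" "d' = - (c' * x)"
        by (simp_all add: eq_neg_iff_add_eq_0 add.commute)
      then show False
        using assms(2) by simp
    qed
    then show ?thesis
      by (simp add: Some moebius_fraction[OF assms(1)] algebra_simps)
  qed
qed

lemma moebius_scalar:
  assumes "k \<noteq> 0"
  shows "moebius k 0 0 k = id"
proof
  fix p show "moebius k 0 0 k p = id p"
    using assms by (cases p) (simp_all add: fraction_def)
qed

text \<open>
  Comparing the sum over \<open>S\<close> with the sum over its image gives \<open>(u - 1) \<Sum>S = 4 w = 0\<close>, which
  settles \<open>u \<noteq> 1\<close>. A nontrivial translation pairs up the four elements, and both pairs have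
  sum \<open>w\<close>.
\<close>
lemma sum_zero_of_affine_invariant:
  fixes S :: "'a::field set"
  assumes char: "\<And>x :: 'a. x + x = 0"
    and S: "card S = 4" and inv: "(\<lambda>x. u * x + w) ` S = S"
    and nontrivial: "u \<noteq> 1 \<or> w \<noteq> 0" and "u \<noteq> 0"
  shows "\<Sum>S = 0"
proof (cases "u = 1")
  case False
  have "inj_on (\<lambda>x. u * x + w) S"
    using \<open>u \<noteq> 0\<close> by (simp add: inj_on_def)
  then have "\<Sum>S = (\<Sum>x\<in>S. u * x + w)"
    using sum.reindex[of "\<lambda>x. u * x + w" S "\<lambda>x. x"] by (simp add: inv)
  also have "\<dots> = u * \<Sum>S + of_nat 4 * w"
    by (simp add: sum.distrib sum_distrib_left S)
  also have "of_nat 4 * w = (w + w) + (w + w)"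
    by (simp add: algebra_simps)
  also have "\<dots> = 0"
    by (simp only: char)
  finally have "(u - 1) * \<Sum>S = 0"
    by (simp add: algebra_simps)
  then show ?thesis
    using False by simp
next
  case True
  then have "w \<noteq> 0"
    using nontrivial by simp
  have closed: "x + w \<in> S" if "x \<in> S" for x
    using inv that True by auto
  have fin: "finite S"
    using S by (simp add: card_ge_0_finite)
  obtain x where x: "x \<in> S"
    using S by fastforce
  have "card (S - {x, x + w}) = 2"
    using S x closed[OF x] fin \<open>w \<noteq> 0\<close> by (simp add: card_Diff_subset)
  then obtain y z where yz: "S - {x, x + w} = {y, z}" "y \<noteq> z"
    by (auto simp: card_2_iff)
  then have y: "y \<in> S" "y \<noteq> x" "y \<noteq> x + w"
    by auto
  have "y + w \<noteq> x"
  proof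
    assume "y + w = x"
    then have "x + w = y + (w + w)"
      by (simp flip: \<open>y + w = x\<close> add: add.assoc)
    then have "x + w = y"
      by (simp only: char add_0_right)
    then show False
      using y(3) by simp
  qed
  then have "y + w \<in> S - {x, x + w}"
    using closed[OF y(1)] y(2) by simp
  then have "z = y + w"
    using yz \<open>w \<noteq> 0\<close> by auto
  have "S = {x, x + w} \<union> {y, y + w}"
    using yz(1) x closed[OF x] \<open>z = y + w\<close> by blast
  moreover have "{x, x + w} \<inter> {y, y + w} = {}"
    using yz(1) \<open>z = y + w\<close> by blast
  ultimately have "\<Sum>S = (x + (x + w)) + (y + (y + w))"
    using \<open>w \<noteq> 0\<close> by (simp add: sum.union_disjoint)
  also have "\<dots> = ((x + x) + (y + y)) + (w + w)"
    by (simp add: algebra_simps)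
  also have "\<dots> = 0"
    by (simp only: char)
  finally show ?thesis .
qed

text \<open>
  A finite field is represented as a subset of an ambient field type, because its order depends on
  a number that is a variable of the final theorem.
\<close>
locale finite_subfield =
  fixes K :: "'a::field set"
  assumes finite_K: "finite K"
    and one_in: "1 \<in> K"
    and add_in: "x \<in> K \<Longrightarrow> y \<in> K \<Longrightarrow> x + y \<in> K"
    and mult_in: "x \<in> K \<Longrightarrow> y \<in> K \<Longrightarrow> x * y \<in> K"
    and uminus_in: "x \<in> K \<Longrightarrow> - x \<in> K"
    and inverse_in: "x \<in> K \<Longrightarrow> inverse x \<in> K"
begin

lemma zero_in: "0 \<in> K"
  using add_in[OF one_in uminus_in[OF one_in]] by simp

lemma diff_in: "x \<in> K \<Longrightarrow> y \<in> K \<Longrightarrow> x - y \<in> K"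
  using add_in[OF _ uminus_in, of x y] by simp

lemma divide_in: "x \<in> K \<Longrightarrow> y \<in> K \<Longrightarrow> x / y \<in> K"
  using mult_in[OF _ inverse_in, of x y] by (simp add: divide_inverse)

lemmas closed = zero_in one_in add_in mult_in uminus_in diff_in divide_in

definition line :: "'a option set" where
  "line = insert None (Some ` K)"

definition PGL :: "('a option \<Rightarrow> 'a option) set" where
  "PGL = {moebius a b c d |a b c d. {a, b, c, d} \<subseteq> K \<and> a * d - b * c \<noteq> 0}"

lemma PGL_I: "{a, b, c, d} \<subseteq> K \<Longrightarrow> a * d - b * c \<noteq> 0 \<Longrightarrow> moebius a b c d \<in> PGL"
  unfolding PGL_def by blast

lemma PGL_E:
  assumes "g \<in> PGL"
  obtains a b c d where "g = moebius a b c d" "{a, b, c, d} \<subseteq> K" "a * d - b * c \<noteq> 0"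
  using assms unfolding PGL_def by blast

lemma perm_group_PGL: "perm_group PGL"
proof -
  have "id \<in> PGL"
    using PGL_I[of 1 0 0 1] by (simp add: moebius_scalar closed)
  moreover have "g \<circ> h \<in> PGL" if gh: "g \<in> PGL" "h \<in> PGL" for g h
  proof -
    obtain a b c d where g: "g = moebius a b c d" "{a, b, c, d} \<subseteq> K" "a * d - b * c \<noteq> 0"
      using gh(1) by (rule PGL_E)
    obtain a' b' c' d' where h: "h = moebius a' b' c' d'" "{a', b', c', d'} \<subseteq> K" "a' * d' - b' * c' \<noteq> 0"
      using gh(2) by (rule PGL_E)
    have "(a * a' + b * c') * (c * b' + d * d') - (a * b' + b * d') * (c * a' + d * c') =
        (a * d - b * c) * (a' * d' - b' * c')"
      by (simp add: algebra_simps)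
    also have "\<dots> \<noteq> 0"
      using g(3) h(3) by simp
    finally show ?thesis
      unfolding g(1) h(1) moebius_comp[OF g(3) h(3)]
      using g(2) h(2) by (intro PGL_I) (simp_all add: closed)
  qed
  moreover have "\<exists>h\<in>PGL. h \<circ> g = id \<and> g \<circ> h = id" if g_in: "g \<in> PGL" for g
  proof -
    obtain a b c d where g: "g = moebius a b c d" "{a, b, c, d} \<subseteq> K" "a * d - b * c \<noteq> 0"
      using g_in by (rule PGL_E)
    have det: "d * a - (- b) * (- c) \<noteq> 0"
      using g(3) by (simp add: mult.commute)
    have "moebius d (- b) (- c) a \<in> PGL"
      using g(2) det by (intro PGL_I) (simp_all add: closed)
    moreover have "moebius d (- b) (- c) a \<circ> g = id"
      unfolding g(1) moebius_comp[OF det g(3)]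
      using moebius_scalar[OF g(3)] by (simp add: algebra_simps)
    moreover have "g \<circ> moebius d (- b) (- c) a = id"
      unfolding g(1) moebius_comp[OF g(3) det]
      using moebius_scalar[OF g(3)] by (simp add: algebra_simps)
    ultimately show ?thesis
      by blast
  qed
  ultimately show ?thesis
    by (simp add: perm_group_def)
qed

lemma PGL_line:
  assumes "g \<in> PGL" "p \<in> line"
  shows "g p \<in> line"
proof -
  obtain a b c d where g: "g = moebius a b c d" "{a, b, c, d} \<subseteq> K" "a * d - b * c \<noteq> 0"
    using assms(1) by (rule PGL_E)
  then show ?thesis
    using assms(2) by (cases p) (auto simp: line_def fraction_def closed)
qed

lemma inverse_PGL:
  assumes "g \<in> PGL"
  obtains h where "h \<in> PGL" "\<And>p. h (g p) = p" "\<And>p. g (h p) = p"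
proof -
  obtain h where "h \<in> PGL" "h \<circ> g = id" "g \<circ> h = id"
    using perm_groupD(3)[OF perm_group_PGL assms] by blast
  then show ?thesis
    using that by (metis comp_apply id_apply)
qed

lemma PGL_to_infinity:
  assumes "p \<in> line"
  shows "\<exists>g\<in>PGL. g p = None"
proof (cases p)
  case None
  then show ?thesis
    using perm_groupD(1)[OF perm_group_PGL] by (intro bexI[of _ id]) simp_all
next
  case (Some x)
  then have "moebius 0 1 1 (- x) \<in> PGL"
    using assms by (intro PGL_I) (auto simp: line_def closed)
  then show ?thesis
    by (intro bexI[of _ "moebius 0 1 1 (- x)"]) (simp_all add: Some fraction_def)
qed

text \<open>
  Send the first point to infinity and then correct the images of the other two by an affine map.
\<close>
lemma PGL_to_standard_triple:
  assumes "distinct [a, b, c]" "{a, b, c} \<subseteq> line"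
  shows "\<exists>g\<in>PGL. g a = None \<and> g b = Some 0 \<and> g c = Some 1"
proof -
  obtain g where g: "g \<in> PGL" "g a = None"
    using PGL_to_infinity assms(2) by auto
  have "inj g"
    by (rule perm_group_inj[OF perm_group_PGL g(1)])
  then have ne: "g b \<noteq> None" "g c \<noteq> None" "g b \<noteq> g c"
    using assms(1) g(2) inj_eq[OF \<open>inj g\<close>, of b a] inj_eq[OF \<open>inj g\<close>, of c a]
      inj_eq[OF \<open>inj g\<close>, of b c] by (auto simp del: not_None_eq)
  obtain y where y: "g b = Some y" "y \<in> K"
    using PGL_line[OF g(1), of b] assms(2) ne by (auto simp: line_def)
  obtain z where z: "g c = Some z" "z \<in> K"
    using PGL_line[OF g(1), of c] assms(2) ne by (auto simp: line_def)
  have "y \<noteq> z"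
    using ne y z by simp
  then have "moebius 1 (- y) 0 (z - y) \<in> PGL"
    using y z by (intro PGL_I) (simp_all add: closed)
  then have "moebius 1 (- y) 0 (z - y) \<circ> g \<in> PGL"
    by (rule perm_groupD(2)[OF perm_group_PGL _ g(1)])
  then show ?thesis
    using \<open>y \<noteq> z\<close>
    by (intro bexI[of _ "moebius 1 (- y) 0 (z - y) \<circ> g"]) (simp_all add: g(2) y z fraction_def)
qed

lemma PGL_fixing_infinity:
  assumes "g \<in> PGL" "g None = None"
  obtains u w where "u \<noteq> 0" "\<And>x. g (Some x) = Some (u * x + w)"
proof -
  obtain a b c d where g: "g = moebius a b c d" "{a, b, c, d} \<subseteq> K" "a * d - b * c \<noteq> 0"
    using assms(1) by (rule PGL_E)
  have "c = 0"
    using assms(2) by (simp add: g(1) fraction_def split: if_splits)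
  then have "a \<noteq> 0" "d \<noteq> 0"
    using g(3) by auto
  then show ?thesis
    using that[of "a / d" "b / d"] by (simp add: g(1) \<open>c = 0\<close> fraction_def add_divide_distrib)
qed

lemma card_line: "card line = card K + 1"
proof -
  have "card (Some ` K) = card K"
    by (rule card_image) simp
  moreover have "None \<notin> Some ` K"
    by blast
  ultimately show ?thesis
    using finite_K by (simp add: line_def)
qed

text \<open>
  Everything reduces by conjugation to the triple \<open>\<infinity>, 0, 1\<close>: a map fixing infinity is affine, and
  an affine map fixing 0 and 1 is the identity.
\<close>
lemma sharply_3_transitive_PGL: "sharply_3_transitive PGL line"
proof
  show "finite line"
    by (simp add: line_def finite_K)
  have "card {0, 1 :: 'a} \<le> card K"
    by (rule card_mono) (simp_all add: finite_K closed)
  then show "3 \<le> card line"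
    by (simp add: card_line)
  show "perm_group PGL"
    by (rule perm_group_PGL)
  show "g x \<in> line" if "g \<in> PGL" "x \<in> line" for g x
    using that by (rule PGL_line)
  show "\<exists>g\<in>PGL. g a = a' \<and> g b = b' \<and> g c = c'"
    if abc: "distinct [a, b, c]" "{a, b, c} \<subseteq> line" "distinct [a', b', c']" "{a', b', c'} \<subseteq> line"
    for a b c a' b' c'
  proof -
    obtain g where g: "g \<in> PGL" "g a = None" "g b = Some 0" "g c = Some 1"
      using PGL_to_standard_triple[OF abc(1,2)] by blast
    obtain h where h: "h \<in> PGL" "h a' = None" "h b' = Some 0" "h c' = Some 1"
      using PGL_to_standard_triple[OF abc(3,4)] by blast
    obtain h' where h': "h' \<in> PGL" "\<And>p. h' (h p) = p" "\<And>p. h (h' p) = p"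
      using h(1) by (rule inverse_PGL) blast
    show ?thesis
      using h'(2)[of a'] h'(2)[of b'] h'(2)[of c']
      by (intro bexI[of _ "h' \<circ> g"] perm_groupD(2)[OF perm_group_PGL h'(1) g(1)])
         (simp add: g h)
  qed
  show "g = id"
    if g: "g \<in> PGL" and abc: "distinct [a, b, c]" "{a, b, c} \<subseteq> line"
      and fixes3: "g a = a" "g b = b" "g c = c" for g a b c
  proof -
    obtain h where h: "h \<in> PGL" "h a = None" "h b = Some 0" "h c = Some 1"
      using PGL_to_standard_triple[OF abc] by blast
    obtain h' where h': "h' \<in> PGL" "\<And>p. h' (h p) = p" "\<And>p. h (h' p) = p"
      using h(1) by (rule inverse_PGL) blast
    have conj: "h \<circ> (g \<circ> h') \<in> PGL"
      by (intro perm_groupD(2)[OF perm_group_PGL] h h' g)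
    have pre: "h' None = a" "h' (Some 0) = b" "h' (Some 1) = c"
      using h'(2)[of a] h'(2)[of b] h'(2)[of c] by (simp_all add: h)
    have "(h \<circ> (g \<circ> h')) None = None"
      by (simp add: pre fixes3 h)
    then obtain u w where uw: "\<And>x. (h \<circ> (g \<circ> h')) (Some x) = Some (u * x + w)"
      using PGL_fixing_infinity[OF conj] by blast
    have "w = 0" "u = 1"
      using uw[of 0] uw[of 1] by (simp_all add: pre fixes3 h)
    then have conj_id: "h (g (h' p)) = p" for p
      using uw pre fixes3 h by (cases p) simp_all
    show "g = id"
    proof
      fix p
      have "h' (h (g (h' (h p)))) = h' (h p)"
        by (simp only: conj_id)
      then show "g p = id p"
        by (simp add: h')
    qed
  qed
qed

text \<open>
  Conjugation by a map \<open>h\<close> that sends \<open>e\<close> to infinity turns the stabiliser of \<open>e\<close> into affine maps,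
  so that a stabilised 4-set gets coordinate sum zero and each coordinate is the sum of the others.
\<close>
lemma PGL_has_barycentres:
  assumes char: "\<And>x :: 'a. x + x = 0"
  shows "sharply_3_transitive.has_barycentres PGL line"
proof -
  interpret sharply_3_transitive PGL line
    by (rule sharply_3_transitive_PGL)
  show ?thesis
    unfolding has_barycentres_def
  proof (intro ballI)
    fix e assume "e \<in> line"
    then obtain h where h: "h \<in> PGL" "h e = None"
      using PGL_to_infinity by blast
    obtain h' where h': "h' \<in> PGL" "\<And>p. h' (h p) = p" "\<And>p. h (h' p) = p"
      using h(1) by (rule inverse_PGL) blast
    have "h' None = e"
      using h'(2)[of e] by (simp add: h)
    define v where "v = (\<lambda>p. the (h p))"
    have v: "h p = Some (v p)" if "p \<noteq> e" for p
    proof -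
      have "h p \<noteq> None"
      proof
        assume "h p = None"
        then show False
          using h'(2)[of p] \<open>h' None = e\<close> that by simp
      qed
      then show ?thesis
        by (auto simp: v_def)
    qed
    show "\<exists>\<beta>. \<forall>A\<subseteq>line - {e}. card A = 4 \<longrightarrow> \<not> regular_pair A {e} \<longrightarrow> (\<exists>x\<in>A. x = \<beta> (A - {x}))"
    proof (intro exI[of _ "\<lambda>T. h' (Some (sum v T))"] allI impI)
      fix A assume A: "A \<subseteq> line - {e}" "card A = 4" "\<not> regular_pair A {e}"
      then obtain g where g: "g \<in> PGL" "g ` A = A" "g e = e" "g \<noteq> id"
        by (auto simp: regular_pair_def)
      have "e \<notin> A"
        using A(1) by blast
      have finA: "finite A"
        using A(2) by (simp add: card_ge_0_finite)
      have conj: "h \<circ> (g \<circ> h') \<in> PGL"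
        by (intro perm_groupD(2)[OF perm_group_PGL] h h' g)
      have "(h \<circ> (g \<circ> h')) None = None"
        by (simp add: \<open>h' None = e\<close> g h)
      then obtain u w where "u \<noteq> 0" and uw: "\<And>x. (h \<circ> (g \<circ> h')) (Some x) = Some (u * x + w)"
        using PGL_fixing_infinity[OF conj] by blast
      have gv: "v (g p) = u * v p + w" if "p \<in> A" for p
      proof -
        have "p \<noteq> e" "g p \<in> A"
          using that \<open>e \<notin> A\<close> g(2) by auto
        then have "h (g (h' (h p))) = Some (v (g p))"
          using v[of "g p"] \<open>e \<notin> A\<close> by (auto simp: h')
        then show ?thesis
          using uw[of "v p"] by (simp add: v[OF \<open>p \<noteq> e\<close>])
      qed
      have "inj_on v A"
      proof (rule inj_onI)
        fix p q assume pq: "p \<in> A" "q \<in> A" "v p = v q"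
        have "p \<noteq> e" "q \<noteq> e"
          using \<open>e \<notin> A\<close> pq(1,2) by auto
        then have "h p = h q"
          using v[of p] v[of q] pq(3) by simp
        then show "p = q"
          using h'(2) by metis
      qed
      have "\<Sum>(v ` A) = 0"
      proof (rule sum_zero_of_affine_invariant[OF char _ _ _ \<open>u \<noteq> 0\<close>])
        show "card (v ` A) = 4"
          using \<open>inj_on v A\<close> A(2) by (simp add: card_image)
        have "(\<lambda>x. u * x + w) ` v ` A = v ` (g ` A)"
          by (simp add: image_image gv)
        then show "(\<lambda>x. u * x + w) ` v ` A = v ` A"
          by (simp only: g(2))
        show "u \<noteq> 1 \<or> w \<noteq> 0"
        proof (rule ccontr)
          assume "\<not> ?thesis"
          then have conj_id: "h (g (h' p)) = p" for p
            using uw \<open>h' None = e\<close> g(3) h(2) by (cases p) simp_all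
          have "g p = id p" for p
          proof -
            have "h' (h (g (h' (h p)))) = h' (h p)"
              by (simp only: conj_id)
            then show ?thesis
              by (simp add: h')
          qed
          then show False
            using g(4) by blast
        qed
      qed
      then have total: "sum v A = 0"
        using \<open>inj_on v A\<close> by (simp add: sum.reindex)
      obtain x where "x \<in> A"
        using A(2) by fastforce
      have "v x + sum v (A - {x}) = 0"
        using total sum.remove[OF finA \<open>x \<in> A\<close>, of v] by simp
      then have "v x + (v x + sum v (A - {x})) = v x"
        by simp
      then have "sum v (A - {x}) = v x"
        by (simp add: char flip: add.assoc)
      moreover have "x \<noteq> e"
        using \<open>x \<in> A\<close> \<open>e \<notin> A\<close> by auto
      ultimately have "h x = Some (sum v (A - {x}))"
        by (simp add: v)
      then have "x = h' (Some (sum v (A - {x})))"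
        using h'(2) by metis
      then show "\<exists>x\<in>A. x = h' (Some (sum v (A - {x})))"
        using \<open>x \<in> A\<close> by blast
    qed
  qed
qed

end

section \<open>Finite fields of order a power of two\<close>

lemma bit_alg_closure_add_self [simp]: "x + x = (0 :: bit alg_closure)"
proof -
  have "(1 :: bit alg_closure) + 1 = to_ac (1 + 1)"
    by (simp only: to_ac_add to_ac_1)
  also have "\<dots> = 0"
    by simp
  finally have "x * (1 + 1) = 0"
    by simp
  then show ?thesis
    by (simp add: algebra_simps)
qed

lemma frobenius_power_add:
  "(x + y :: bit alg_closure) ^ (2 ^ n) = x ^ (2 ^ n) + y ^ (2 ^ n)"
proof (induction n)
  case (Suc n)
  have sq: "(a + b)\<^sup>2 = a\<^sup>2 + b\<^sup>2" for a b :: "bit alg_closure"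
  proof -
    have "(a + b)\<^sup>2 = a\<^sup>2 + b\<^sup>2 + (a * b + a * b)"
      by (simp only: power2_eq_square algebra_simps)
    then show ?thesis
      by simp
  qed
  have "(z :: bit alg_closure) ^ (2 ^ Suc n) = (z ^ (2 ^ n))\<^sup>2" for z
    by (simp flip: power_mult add: mult.commute)
  then show ?case
    by (simp only: Suc.IH sq)
qed simp

text \<open>
  The polynomial \<open>x ^ q - x\<close> splits over the algebraic closure, and it has no multiple root because
  its derivative is the constant \<open>-1\<close>. Hence it has as many roots as its degree.
\<close>
lemma card_frobenius_fixed_points:
  assumes "f > 0"
  shows "card {x :: bit alg_closure. x ^ (2 ^ f) = x} = 2 ^ f"
proof -
  define q :: nat where "q = 2 ^ f"
  have "q \<ge> 2"
    unfolding q_def using assms self_le_power[of 2 f] by simp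
  define p :: "bit alg_closure poly" where "p = monom 1 q - monom 1 1"
  have "degree (monom 1 q + - monom 1 1 :: bit alg_closure poly) = q"
    using \<open>q \<ge> 2\<close> by (subst degree_add_eq_left) (simp_all add: degree_monom_eq)
  then have deg: "degree p = q"
    by (simp add: p_def)
  have "p \<noteq> 0"
    using deg \<open>q \<ge> 2\<close> by auto
  have roots: "poly p x = 0 \<longleftrightarrow> x ^ (2 ^ f) = x" for x
    by (simp add: p_def poly_monom q_def)
  have "even q"
    using assms by (simp add: q_def)
  then have q0: "of_nat q = (0 :: bit alg_closure)"
    by (metis bit_alg_closure_add_self evenE mult_2 of_nat_add)
  have "pderiv p = - 1"
    by (simp add: p_def pderiv_diff pderiv_monom q0)
  obtain A where A: "size A = degree p" "p = smult (lead_coeff p) (\<Prod>x\<in>#A. [:-x, 1:])"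
    using alg_closed_imp_factorization[OF \<open>p \<noteq> 0\<close>] by blast
  have setA: "set_mset A = {x. poly p x = 0}"
    using \<open>p \<noteq> 0\<close> by (subst A(2)) (auto simp: poly_prod_mset prod_mset_zero_iff image_iff)
  have simple: "count A x \<le> 1" for x
  proof (rule ccontr)
    assume "\<not> ?thesis"
    then have "{#x, x#} \<subseteq># A"
      by (simp add: subseteq_mset_def)
    then obtain B where "A = {#x, x#} + B"
      by (metis subset_mset.le_iff_add)
    then have "p = [:-x, 1:] * ([:-x, 1:] * smult (lead_coeff p) (\<Prod>x\<in>#B. [:-x, 1:]))"
      by (subst A(2)) (simp add: mult.assoc)
    then obtain r where "p = [:-x, 1:] * ([:-x, 1:] * r)"
      by blast
    then have "poly (pderiv p) x = poly (pderiv ([:-x, 1:] * ([:-x, 1:] * r))) x"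
      by (simp only:)
    also have "\<dots> = 0"
      by (simp only: pderiv_mult poly_add poly_mult) simp
    finally have "poly (pderiv p) x = 0" .
    with \<open>pderiv p = - 1\<close> show False
      by simp
  qed
  have "size A = card (set_mset A)"
  proof -
    have "size A = (\<Sum>x\<in>set_mset A. count A x)"
      by (rule size_multiset_overloaded_eq)
    also have "\<dots> = (\<Sum>x\<in>set_mset A. 1)"
      by (rule sum.cong) (use simple in \<open>auto intro: le_antisym simp: Suc_le_eq\<close>)
    finally show ?thesis
      by simp
  qed
  then show ?thesis
    using A(1) deg setA by (simp add: roots q_def)
qed

section \<open>Existence of the designs\<close>

text \<open>The map \<open>x ^ (2 ^ f)\<close> is a ring homomorphism, so its fixed points are closed under the operations.\<close>
lemma finite_subfield_of_order_power_of_two: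
  assumes "f > 0"
  shows "finite_subfield {x :: bit alg_closure. x ^ (2 ^ f) = x}"
proof
  have "card {x :: bit alg_closure. x ^ (2 ^ f) = x} > 0"
    by (simp add: card_frobenius_fixed_points[OF assms])
  then show "finite {x :: bit alg_closure. x ^ (2 ^ f) = x}"
    by (rule card_ge_0_finite)
  fix x y :: "bit alg_closure"
  assume x: "x \<in> {x. x ^ (2 ^ f) = x}"
  have "- x = x"
    by (rule minus_unique) (rule bit_alg_closure_add_self)
  then show "- x \<in> {x. x ^ (2 ^ f) = x}"
    using x by (simp only:)
  show "inverse x \<in> {x. x ^ (2 ^ f) = x}"
    using x by (simp add: power_inverse)
  assume y: "y \<in> {x. x ^ (2 ^ f) = x}"
  show "x + y \<in> {x. x ^ (2 ^ f) = x}"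
    using x y by (simp add: frobenius_power_add)
  show "x * y \<in> {x. x ^ (2 ^ f) = x}"
    using x y by (simp add: power_mult_distrib)
qed simp

lemma t_design_on_nat:
  fixes X :: "'x set"
  assumes "finite X" "finite F" and blocks: "\<And>B. B \<in> F \<Longrightarrow> B \<subseteq> X \<and> card B = k"
    and counts: "\<And>T. T \<subseteq> X \<Longrightarrow> card T = t \<Longrightarrow> card {B \<in> F. T \<subseteq> B} = l"
  shows "\<exists>(Y :: nat set) \<B>. t_design t (card X) k l Y \<B> \<and> simple_blocks \<B>"
proof -
  obtain \<phi> :: "'x \<Rightarrow> nat" where inj: "inj_on \<phi> X"
    using finite_imp_inj_to_nat_seg[OF assms(1)] by blast
  have sub: "\<phi> ` A \<subseteq> \<phi> ` B \<longleftrightarrow> A \<subseteq> B" if "A \<subseteq> X" "B \<subseteq> X" for A B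
  proof -
    have "\<phi> a \<in> \<phi> ` B \<longleftrightarrow> a \<in> B" if "a \<in> A" for a
      using inj_on_image_mem_iff[OF inj _ \<open>B \<subseteq> X\<close>] \<open>A \<subseteq> X\<close> that by blast
    then show ?thesis
      by (simp add: image_subset_iff subset_eq)
  qed
  have inj': "inj_on ((`) \<phi>) F"
    using inj blocks by (meson inj_on_image_eq_iff inj_onI)
  define \<B> where "\<B> = mset_set ((`) \<phi> ` F)"
  have set: "set_mset \<B> = (`) \<phi> ` F"
    using assms(2) by (simp add: \<B>_def)
  have "t_design t (card X) k l (\<phi> ` X) \<B>"
    unfolding t_design_def set
  proof (intro conjI ballI allI impI)
    show "finite (\<phi> ` X)"
      using assms(1) by simp
    show "card (\<phi> ` X) = card X"
      by (rule card_image[OF inj])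
    fix C assume "C \<in> (`) \<phi> ` F"
    then obtain B where B: "C = \<phi> ` B" "B \<in> F"
      by blast
    then show "C \<subseteq> \<phi> ` X"
      using blocks by blast
    show "card C = k"
      using blocks[OF B(2)] inj by (simp add: B(1) card_image inj_on_subset)
  next
    fix T assume T: "T \<subseteq> \<phi> ` X \<and> card T = t"
    then obtain S where S: "S \<subseteq> X" "T = \<phi> ` S"
      by (meson subset_image_iff)
    have "card S = t"
      using T S inj by (metis card_image inj_on_subset)
    have "{C \<in> (`) \<phi> ` F. T \<subseteq> C} = (`) \<phi> ` {B \<in> F. S \<subseteq> B}"
      using sub[OF S(1)] blocks by (auto simp: S(2))
    moreover have "card ((`) \<phi> ` {B \<in> F. S \<subseteq> B}) = card {B \<in> F. S \<subseteq> B}"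
      by (rule card_image) (rule inj_on_subset[OF inj'], blast)
    ultimately show "size {#C \<in># \<B>. T \<subseteq> C#} = l"
      using assms(2) counts[OF S(1) \<open>card S = t\<close>]
      by (simp add: \<B>_def filter_mset_mset_set)
  qed
  moreover have "simple_blocks \<B>"
    by (simp add: simple_blocks_def \<B>_def count_mset_set')
  ultimately show ?thesis
    by blast
qed

theorem theorem3p2:
  fixes f :: nat
  assumes "f > 0" and "gcd f 6 = 1" and "f \<noteq> 1"
  shows "\<exists>(X :: nat set) \<B>.
           t_design 3 (2 * (2 ^ f + 1)) 5 (15 * (2 ^ f - 1)) X \<B> \<and> simple_blocks \<B>"
proof -
  have "5 \<le> f"
  proof (rule ccontr)
    assume "\<not> 5 \<le> f"
    then have "f \<in> {2, 3, 4}"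
      using assms(1,3) by auto
    then show False
      using assms(2) by (auto simp: gcd_nat.simps[of _ 6] gcd_nat.simps)
  qed
  then obtain j where j: "f = j + 5"
    using le_Suc_ex by (metis add.commute)
  define r :: nat where "r = 2 ^ (j + 4)"
  have q: "2 ^ f = 2 * r" "16 \<le> r"
    by (simp_all add: r_def j power_add)
  define K where "K = {x :: bit alg_closure. x ^ (2 ^ f) = x}"
  interpret K: finite_subfield K
    unfolding K_def by (rule finite_subfield_of_order_power_of_two[OF assms(1)])
  interpret L: sharply_3_transitive K.PGL K.line
    by (rule K.sharply_3_transitive_PGL)
  have card: "card K.line = 2 * r + 1"
  proof -
    have "card K = 2 * r"
      unfolding K_def card_frobenius_fixed_points[OF assms(1)] by (rule q(1))
    then show ?thesis
      by (simp add: K.card_line)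
  qed
  have "L.has_barycentres"
    by (rule K.PGL_has_barycentres) simp
  then obtain F where F: "finite F" "\<forall>B\<in>F. B \<subseteq> L.doubled_points \<and> card B = 5"
    "\<forall>T\<subseteq>L.doubled_points. card T = 3 \<longrightarrow> card {B \<in> F. T \<subseteq> B} = 15 * (2 * r - 1)"
    using L.ex_simple_3_design[OF _ card q(2)] by blast
  have "\<exists>(X :: nat set) \<B>.
      t_design 3 (card L.doubled_points) 5 (15 * (2 * r - 1)) X \<B> \<and> simple_blocks \<B>"
  proof (rule t_design_on_nat[OF L.finite_doubled_points F(1)])
    show "B \<subseteq> L.doubled_points \<and> card B = 5" if "B \<in> F" for B
      using F(2) that by (rule bspec)
    show "card {B \<in> F. T \<subseteq> B} = 15 * (2 * r - 1)" if "T \<subseteq> L.doubled_points" "card T = 3" for T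
      using F(3)[rule_format, OF that] .
  qed
  moreover have "card L.doubled_points = 2 * (2 ^ f + 1)"
    by (simp add: L.doubled_points_def card_cartesian_product card q(1))
  ultimately show ?thesis
    by (simp add: q(1))
qed

end
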